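(* Let $\mu$ be an arbitrary probability measure on $\mathbb{C}$, and let $X_1, X_2, \ldots$ be iid complex random variables with distribution $\mu$. For each $n \geq 1$ let $k_n$ be a deterministic integer with $0 \le k_n \le n$ and $k_n = o(n)$ as $n\to\infty$, and let $\xi_1^{(n)}, \ldots, \xi_{k_n}^{(n)}$ be a deterministic triangular array of complex numbers. Define \[ p_n(z) := \prod_{j=1}^{n-k_n} (z - X_j) \prod_{l=1}^{k_n} (z - \xi_l^{(n)}). \] Then $\mu'_{p_n}$ converges weakly to $\mu$ in probability as $n \to \infty$; that is, for every bounded continuous $f:\mathbb{C}\to\mathbb{R}$ and every $\varepsilon>0$, $\lim_{n\to\infty}\mathbb{P}\left(\left|\int f\,d\mu'_{p_n} - \int f\,d\mu\right|>\varepsilon\right)=0$.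
   Context: For a polynomial $f$ of degree $n$, $\mu_f := \frac{1}{n}\sum_{z: f(z)=0}\delta_z$ (roots counted with multiplicity) is the empirical measure of its roots, and $\mu'_f := \mu_{f'}$ is the empirical measure of its critical points (zeros of $f'$, counted with multiplicity, normalized by $\deg f' $). *)

theory Defs
  imports "HOL-Probability.Probability" "HOL-Computational_Algebra.Polynomial"
    "HOL-Library.Landau_Symbols"
begin

definition root_integral :: "complex poly \<Rightarrow> (complex \<Rightarrow> real) \<Rightarrow> real" where
  "root_integral q f =
     (\<Sum>z\<in>{z. poly q z = 0}. real (order z q) * f z) / real (degree q)"

definition crit_integral :: "complex poly \<Rightarrow> (complex \<Rightarrow> real) \<Rightarrow> real" where
  "crit_integral p f = root_integral (pderiv p) f"

definition pn :: "(nat \<Rightarrow> nat) \<Rightarrow> (nat \<Rightarrow> nat \<Rightarrow> complex) \<Rightarrow> (nat \<Rightarrow> complex) \<Rightarrow> nat \<Rightarrow> complex poly" where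
  "pn k \<xi> x n = (\<Prod>j<n - k n. [:- x j, 1:]) * (\<Prod>l<k n. [:- \<xi> n l, 1:])"

end

theory Submission
  imports Defs "HOL-Complex_Analysis.Cauchy_Integral_Formula"
    "HOL-Computational_Algebra.Fundamental_Theorem_Algebra" "HOL-Real_Asymp.Real_Asymp"
begin

text \<open>
  Write L = p'/p, the sum of 1/(z - x) over the roots x of p.  By Jensen's formula on circles, averaged
  over the centres, the difference of the sums of a compactly supported f over the critical points and
  over the roots is, up to a small multiple of n, an integral of ln |L| against a bounded compactly
  supported kernel.  So it suffices that the integral of |ln |L|| over a disc is o(n).

  The positive part of ln |L| is always o(n), since 1/|z - x| is locally integrable uniformly in x.  On a
  disc, ln |L| is a constant plus a sum of at most 2n functions that are bounded in L^2; hence the negative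
  part is o(n) as soon as the area of the set where |L| < 1 tends to 0.

  If \<mu> is not a point mass, then for each z the value L(z) contains a sum of many iid nondegenerate terms.
  Testing against a Gaussian bounds the probability that |L(z)| < 1 by the integral of |char(t)|^m against
  the standard normal law, which tends to 0; Fubini turns this into a statement on the expected area.  The
  weak law of large numbers identifies the limit, and if \<mu> is a point mass then all but k_n critical
  points coincide with the atom.
\<close>

section \<open>Area integrals of logarithmic kernels\<close>

text \<open>The obstacle is that \<mu> has no moments and the \<xi> are arbitrary: the logarithmic
  potential of \<mu> may not exist, so the potentials of p and p' are not studied separately. In ln
  |L| the uncontrolled contributions of far zeros are gathered into one constant. That constant
  needs only a lower bound, and it comes from ln |L| being nonnegative on most of the disc. This is
  why the threshold 1 for |L| suffices and why an area is the right input, rather than a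
  quantitative bound on how small |L| gets at given points. The anti-concentration bound is uniform
  in a deterministic shift, and the \<xi> enter L(z) precisely as such a shift. Compactly supported
  test functions leave open that critical points escape to infinity; testing the critical measure
  against a cutoff of nearly full \<mu>-mass excludes this and yields all bounded continuous f.
  Measurability of the integral over the critical points is not established, so convergence in
  probability is expressed through covering events.\<close>

lemma borel_measurable_ball [measurable]:
  "ball (c::'a::metric_space) r \<in> sets borel" "cball c r \<in> sets borel"
  by auto

lemma borel_measurable_ln_dist [measurable]:
  "(\<lambda>z::complex. ln (cmod (z - x))) \<in> borel_measurable borel"
  by measurable

lemma integrable_lborel_translate_iff:
  fixes f :: "'a::euclidean_space \<Rightarrow> 'b::{banach, second_countable_topology}"
  shows "integrable lborel (\<lambda>x. f (x + c)) \<longleftrightarrow> integrable lborel f"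
proof -
  have *: "integrable lborel (\<lambda>x. g (d + x))" if "integrable lborel g"
    for g :: "'a \<Rightarrow> 'b" and d
  proof -
    have "integrable (distr lborel borel ((+) d)) g"
      using that by (simp add: lborel_distr_plus)
    thus ?thesis by (subst (asm) integrable_distr_eq) (use that in auto)
  qed
  show ?thesis
    using *[of f c] *[of "\<lambda>x. f (x + c)" "-c"] by (auto simp: add_ac)
qed

lemma integral_lborel_translate:
  fixes f :: "'a::euclidean_space \<Rightarrow> 'b::{banach, second_countable_topology}"
  shows "(\<integral>x. f (x + c) \<partial>lborel) = (\<integral>x. f x \<partial>lborel)"
proof (cases "integrable lborel f")
  case True
  have "(\<integral>x. f x \<partial>lborel) = (\<integral>x. f x \<partial>(distr lborel borel ((+) c)))"
    by (simp add: lborel_distr_plus)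
  also have "\<dots> = (\<integral>x. f (c + x) \<partial>lborel)"
    using True by (intro integral_distr) auto
  finally show ?thesis by (simp add: add_ac)
qed (simp_all add: not_integrable_integral_eq integrable_lborel_translate_iff)

text \<open>The disc is covered by dyadic annuli: for 2^-(k+1) <= |z| < 2^-k the integrand is at
  most 2^(k+1), while the disc of radius 2^-k has area pi * 4^-k, so the bounds 2 * pi * 2^-k form a
  convergent geometric series. At z = 0 the integrand is \<open>inverse 0 = 0\<close>.\<close>

lemma integrable_inverse_norm_unit_disc:
  "integrable lborel (\<lambda>z::complex. inverse (cmod z) * indicator (ball 0 1) z)"
proof (rule integrableI_nonneg)
  have le: "ennreal (inverse (cmod z) * indicator (ball 0 1) z)
     \<le> (\<Sum>k. ennreal (2 ^ Suc k) * indicator (ball 0 ((1/2) ^ k)) z)" for z :: complex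
  proof (cases "z \<in> ball 0 1 - {0}")
    case True
    hence z: "0 < cmod z" "cmod z < 1" by auto
    obtain m where m: "(1/2::real) ^ m < cmod z"
      using real_arch_pow_inv[of "cmod z" "1/2"] z by auto
    define k where "k = (LEAST m. (1/2::real) ^ Suc m \<le> cmod z)"
    have ex: "(1/2::real) ^ Suc m \<le> cmod z"
      using m by (simp add: field_simps)
    have k1: "(1/2::real) ^ Suc k \<le> cmod z"
      unfolding k_def by (rule LeastI[of _ m]) (rule ex)
    have k2: "cmod z < (1/2) ^ k"
    proof (cases k)
      case 0 thus ?thesis using z by simp
    next
      case (Suc j)
      hence "\<not> (1/2::real) ^ Suc j \<le> cmod z"
        unfolding k_def by (metis lessI not_less_Least)
      thus ?thesis using Suc by simp
    qed
    have "inverse (cmod z) \<le> inverse ((1/2) ^ Suc k)"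
      using k1 by (intro le_imp_inverse_le) auto
    hence "ennreal (inverse (cmod z) * indicator (ball 0 1) z)
           \<le> ennreal (2 ^ Suc k) * indicator (ball 0 ((1/2) ^ k)) z"
      using k2 z by (auto simp: power_one_over field_simps intro!: ennreal_leI)
    also have "\<dots> \<le> (\<Sum>i. ennreal (2 ^ Suc i) * indicator (ball 0 ((1/2) ^ i)) z)"
      using sum_le_suminf[of "\<lambda>i. ennreal (2 ^ Suc i) * indicator (ball 0 ((1/2) ^ i)) z" "{k}"]
      by (simp del: sum_mult_indicator power_Suc)
    finally show ?thesis .
  qed auto
  have "(\<integral>\<^sup>+z. ennreal (inverse (cmod z) * indicator (ball 0 1) z) \<partial>lborel)
     \<le> (\<integral>\<^sup>+z. (\<Sum>k. ennreal (2 ^ Suc k) * indicator (ball 0 ((1/2) ^ k)) (z::complex)) \<partial>lborel)"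
    by (rule nn_integral_mono) (rule le)
  also have "\<dots> = (\<Sum>k. \<integral>\<^sup>+z. ennreal (2 ^ Suc k) * indicator (ball 0 ((1/2) ^ k)) (z::complex) \<partial>lborel)"
    by (rule nn_integral_suminf) measurable
  also have "\<dots> = (\<Sum>k. ennreal (2 * pi * (1/2) ^ k))"
  proof (rule suminf_cong)
    fix k :: nat
    have "2 ^ Suc k * (pi * ((1/2) ^ k)\<^sup>2) = 2 * pi * (1/2::real) ^ k"
      by (simp add: field_simps power2_eq_square power_mult_distrib flip: power_add)
    thus "(\<integral>\<^sup>+z. ennreal (2 ^ Suc k) * indicator (ball 0 ((1/2) ^ k)) (z::complex) \<partial>lborel)
       = ennreal (2 * pi * (1/2) ^ k)"
      by (simp add: nn_integral_cmult emeasure_ball unit_ball_vol_2 flip: ennreal_mult)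
  qed
  also have "\<dots> < \<infinity>"
    by (subst suminf_ennreal_eq[OF _ sums_mult[OF geometric_sums]]) auto
  finally show "(\<integral>\<^sup>+z. ennreal (inverse (cmod z) * indicator (ball 0 1) z) \<partial>lborel) < \<infinity>" .
qed auto

text \<open>Uniformity in x comes from splitting at distance 1: points nearer to x are handled by
  translating the integral over the unit disc, and farther points contribute at most the area of
  \<open>cball 0 R\<close>. The bound does not see where x lies, which later admits arbitrary
  roots.\<close>

lemma inverse_dist_integral_bound:
  obtains C where "C > 0"
    "\<And>x. set_integrable lborel (cball 0 R) (\<lambda>z. inverse (cmod (z - x)))"
    "\<And>x. (LINT z:cball 0 R|lborel. inverse (cmod (z - x))) \<le> C"
proof -
  define h :: "complex \<Rightarrow> real" where "h = (\<lambda>z. inverse (cmod z) * indicator (ball 0 1) z)"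
  define C where "C = (\<integral>z. h z \<partial>lborel) + measure lborel (cball (0::complex) R)"
  have h: "integrable lborel h" unfolding h_def by (rule integrable_inverse_norm_unit_disc)
  have hx: "integrable lborel (\<lambda>z. h (z - x))" for x
    using integrable_lborel_translate_iff[of h "-x"] h by simp
  have ix: "integrable lborel (indicator (cball (0::complex) R) :: _ \<Rightarrow> real)"
    by (rule integrable_real_indicator) (use emeasure_compact_finite[of "cball (0::complex) R"] in auto)
  have le: "indicator (cball 0 R) z * inverse (cmod (z - x)) \<le> h (z - x) + indicator (cball 0 R) z" for z x
  proof (cases "cmod (z - x) < 1")
    case False
    hence "inverse (cmod (z - x)) \<le> 1" by (intro inverse_le_1_iff[THEN iffD2]) auto
    thus ?thesis by (auto simp: indicator_def h_def)
  qed (auto simp: h_def indicator_def)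
  have int: "set_integrable lborel (cball 0 R) (\<lambda>z. inverse (cmod (z - x)))" for x
    unfolding set_integrable_def
    by (rule Bochner_Integration.integrable_bound[OF Bochner_Integration.integrable_add[OF hx[of x] ix]])
       (use le[of _ x] in \<open>auto simp: h_def intro!: AE_I2\<close>)
  have "(LINT z:cball 0 R|lborel. inverse (cmod (z - x))) \<le> C" for x
  proof -
    have "(LINT z:cball 0 R|lborel. inverse (cmod (z - x)))
        \<le> (\<integral>z. h (z - x) + indicator (cball 0 R) z \<partial>lborel)"
      unfolding set_lebesgue_integral_def
      by (rule integral_mono) (use int[of x] hx[of x] ix le[of _ x] in \<open>auto simp: set_integrable_def\<close>)
    also have "\<dots> = C"
      using integral_lborel_translate[of h "-x"] hx[of x] ix by (simp add: C_def)
    finally show ?thesis .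
  qed
  with int show ?thesis
    by (intro that[of "max C 1"]) (auto simp: le_max_iff_disj)
qed

section \<open>Elementary bounds for the logarithm\<close>

lemma abs_ln_le_inverse_add: "t \<ge> 0 \<Longrightarrow> \<bar>ln t\<bar> \<le> inverse t + (t::real)"
proof (cases "t = 0")
  case False
  assume "t \<ge> 0"
  hence t: "t > 0" using False by auto
  have "ln t \<le> t - 1" by (rule ln_le_minus_one[OF t])
  moreover have "- ln t \<le> inverse t - 1"
    using ln_le_minus_one[of "inverse t"] t by (simp add: ln_inverse)
  ultimately show ?thesis using t by (auto simp: abs_le_iff) (smt (verit) inverse_positive_iff_positive)+
qed auto

text \<open>The bound |ln t| <= 1/t + t is applied at sqrt t, so that squaring produces 1/t instead
  of 1/t^2; the former is locally integrable in the plane, the latter is not. The constant 8 is 2^2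
  from ln t = 2 ln (sqrt t), times 2 from (a + b)^2 <= 2 (a^2 + b^2).\<close>

lemma ln_square_le_inverse_add:
  assumes "t \<ge> 0" shows "(ln t)\<^sup>2 \<le> 8 * (inverse t + (t::real))"
proof (cases "t = 0")
  case False
  hence t: "t > 0" using assms by auto
  have "\<bar>ln t\<bar> = 2 * \<bar>ln (sqrt t)\<bar>" using t by (simp add: ln_sqrt)
  also have "\<dots> \<le> 2 * (inverse (sqrt t) + sqrt t)"
    using abs_ln_le_inverse_add[of "sqrt t"] t by auto
  finally have "(ln t)\<^sup>2 \<le> (2 * (inverse (sqrt t) + sqrt t))\<^sup>2"
    by (metis abs_ge_zero power2_abs power_mono)
  also have "\<dots> \<le> 8 * ((inverse (sqrt t))\<^sup>2 + (sqrt t)\<^sup>2)"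
    using sum_squares_bound[of "inverse (sqrt t)" "sqrt t"]
    by (simp add: power_mult_distrib power2_sum)
  also have "\<dots> = 8 * (inverse t + t)" using t by (simp add: power_inverse)
  finally show ?thesis .
qed auto

lemma set_integrable_ln_dist:
  "set_integrable lborel (cball 0 R) (\<lambda>z. ln (cmod (z - x)))"
proof -
  obtain C where "set_integrable lborel (cball 0 R) (\<lambda>z. inverse (cmod (z - x)))"
    using inverse_dist_integral_bound by metis
  moreover have "set_integrable lborel (cball 0 R) (\<lambda>z. cmod (z - x))"
    unfolding set_integrable_def by (intro borel_integrable_compact continuous_intros) auto
  ultimately have "set_integrable lborel (cball 0 R) (\<lambda>z. inverse (cmod (z - x)) + cmod (z - x))"
    by (rule set_integral_add)
  moreover have "(\<lambda>z. indicator (cball 0 R) z *\<^sub>R ln (cmod (z - x))) \<in> borel_measurable borel"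
    by measurable
  ultimately show ?thesis
    by (elim set_integrable_bound)
       (auto simp: set_borel_measurable_def intro!: AE_I2 order_trans[OF abs_ln_le_inverse_add])
qed

section \<open>Jensen's formula on circles\<close>

text \<open>Mean value property of the holomorphic function Ln (1 - b w): for |w| <= 1 the argument
  has positive real part, so the principal branch is holomorphic on the closed disc, and its value
  at the centre is Ln 1 = 0. The real part is the integrand.\<close>

lemma has_integral_ln_one_minus_circle:
  assumes "cmod b < 1"
  shows "((\<lambda>t. ln (cmod (1 - b * cis (2 * pi * t)))) has_integral 0) {0..1}"
proof -
  have re: "Re (1 - b * w) > 0" if "cmod w \<le> 1" for w
  proof -
    have "cmod (b * w) < 1"
      using assms that mult_left_le[of "cmod w" "cmod b"] by (simp add: norm_mult)
    moreover have "Re (b * w) \<le> cmod (b * w)" by (rule complex_Re_le_cmod)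
    ultimately show ?thesis by simp
  qed
  define f where "f = (\<lambda>w. Ln (1 - b * w))"
  have nonpos: "1 - b * w \<notin> \<real>\<^sub>\<le>\<^sub>0" if "cmod w \<le> 1" for w
    using re[OF that] complex_nonpos_Reals_iff by force
  have "f holomorphic_on cball 0 1"
    unfolding f_def by (intro holomorphic_intros) (use nonpos in auto)
  hence "((\<lambda>u. f u / (u - 0)) has_contour_integral (2 * of_real pi * \<i> * f 0)) (circlepath 0 1)"
    by (intro Cauchy_integral_circlepath)
       (auto intro: holomorphic_on_imp_continuous_on holomorphic_on_subset)
  hence "((\<lambda>t. f (circlepath 0 1 t) / circlepath 0 1 t
            * vector_derivative (circlepath 0 1) (at t within {0..1})) has_integral 0) {0..1}"
    by (simp add: has_contour_integral_def f_def)
  hence "((\<lambda>t. 2 * of_real pi * \<i> * f (cis (2 * pi * t))) has_integral 0) {0..1}"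
    by (rule has_integral_eq[rotated])
       (simp add: vector_derivative_circlepath01, simp add: circlepath cis_conv_exp mult_ac)
  hence "((\<lambda>t. inverse (2 * of_real pi * \<i>) * (2 * of_real pi * \<i> * f (cis (2 * pi * t))))
            has_integral inverse (2 * of_real pi * \<i>) * 0) {0..1}"
    by (rule has_integral_mult_right)
  hence "((\<lambda>t. f (cis (2 * pi * t))) has_integral 0) {0..1}"
    by (simp add: field_simps)
  from has_integral_linear[OF this bounded_linear_Re]
  have "((\<lambda>t. Re (f (cis (2 * pi * t)))) has_integral 0) {0..1}"
    by (simp add: o_def)
  thus ?thesis
  proof (rule has_integral_eq[rotated])
    fix t :: real
    have "1 - b * cis (2 * pi * t) \<noteq> 0" using re[of "cis (2 * pi * t)"] by force
    thus "Re (f (cis (2 * pi * t))) = ln (cmod (1 - b * cis (2 * pi * t)))"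
      by (simp add: f_def)
  qed
qed

text \<open>Both cases reduce to |b| < 1. A point inside the circle is reflected: |a - s e^(i t)| =
  s |1 - (cnj a / s) e^(i t)|; for a point outside, a is factored out. The case |a| = s, where the
  logarithm is singular on the circle, later falls into a null set of centres.\<close>

lemma has_integral_ln_circle:
  assumes s: "s > 0" and ne: "cmod a \<noteq> s"
  shows "((\<lambda>t. ln (cmod (a - of_real s * cis (2 * pi * t)))) has_integral ln (max s (cmod a))) {0..1}"
proof (cases "cmod a < s")
  case True
  define b where "b = cnj a / of_real s"
  have b: "cmod b < 1" using True s by (simp add: b_def norm_divide)
  have eq: "cmod (a - of_real s * cis \<theta>) = s * cmod (1 - b * cis \<theta>)" for \<theta>
  proof -
    have "a - of_real s * cis \<theta> = - (of_real s * cis \<theta> * cnj (1 - b * cis \<theta>))"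
      using s cis_mult[of \<theta> "-\<theta>"] by (simp add: b_def field_simps cis_cnj)
    hence "cmod (a - of_real s * cis \<theta>) = cmod (of_real s * cis \<theta> * cnj (1 - b * cis \<theta>))"
      by (simp only: norm_minus_cancel)
    thus ?thesis using s by (simp add: norm_mult del: complex_cnj_diff)
  qed
  have pos: "cmod (1 - b * cis \<theta>) > 0" for \<theta>
    using b by (auto simp: norm_mult dest!: arg_cong[where f = cmod])
  have "((\<lambda>t. ln s + ln (cmod (1 - b * cis (2 * pi * t)))) has_integral ln s + 0) {0..1}"
    by (intro has_integral_add has_integral_ln_one_minus_circle b)
       (use has_integral_const_real[of "ln s" 0 1] in simp)
  thus ?thesis using True s pos by (simp add: eq ln_mult max_def)
next
  case False
  hence gt: "cmod a > s" using ne by simp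
  define b where "b = of_real s / a"
  have b: "cmod b < 1" using gt s by (simp add: b_def norm_divide divide_less_eq)
  have a: "a \<noteq> 0" using gt s by auto
  have eq: "cmod (a - of_real s * cis \<theta>) = cmod a * cmod (1 - b * cis \<theta>)" for \<theta>
    using a by (simp add: b_def ring_distribs flip: norm_mult)
  have pos: "cmod (1 - b * cis \<theta>) > 0" for \<theta>
    using b by (auto simp: norm_mult dest!: arg_cong[where f = cmod])
  have "((\<lambda>t. ln (cmod a) + ln (cmod (1 - b * cis (2 * pi * t)))) has_integral ln (cmod a) + 0) {0..1}"
    by (intro has_integral_add has_integral_ln_one_minus_circle b)
       (use has_integral_const_real[of "ln (cmod a)" 0 1] in simp)
  thus ?thesis using gt s pos a by (simp add: eq ln_mult max_def)
qed

section \<open>Logarithmic derivatives of polynomials\<close>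

text \<open>At the roots of p the junk value inverse 0 = 0 enters; this is a null set.\<close>

definition log_deriv :: "complex poly \<Rightarrow> complex \<Rightarrow> complex" where
  "log_deriv p z = (\<Sum>x\<in>#proots p. inverse (z - x))"

lemma monic_eq_prod_mset:
  "lead_coeff (p :: complex poly) = 1 \<Longrightarrow> p = (\<Prod>x\<in>#proots p. [:-x, 1:])"
  using complex_poly_decompose_multiset[of p] by simp

lemma poly_prod_mset_linear:
  "poly (\<Prod>x\<in>#A. [:-x, 1:]) (z :: complex) = (\<Prod>x\<in>#A. z - x)"
  by (induction A) (auto simp: algebra_simps)

lemma poly_pderiv_prod_mset_linear:
  "(\<And>x. x \<in># A \<Longrightarrow> z \<noteq> x) \<Longrightarrow> poly (pderiv (\<Prod>x\<in>#A. [:-x, 1:])) (z :: complex)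
     = (\<Prod>x\<in>#A. z - x) * (\<Sum>x\<in>#A. inverse (z - x))"
proof (induction A)
  case (add a A)
  have "z \<noteq> a" using add.prems by auto
  thus ?case using add
    by (simp only: image_mset_add_mset prod_mset.add_mset sum_mset.add_mset pderiv_mult poly_add poly_mult
          poly_prod_mset_linear) (simp add: field_simps pderiv_pCons)
qed auto

lemma poly_pderiv_eq_log_deriv:
  assumes "lead_coeff p = 1" "poly p z \<noteq> 0"
  shows "poly (pderiv p) z = poly p z * log_deriv p z"
proof -
  have "p \<noteq> 0" using assms by auto
  hence ne: "z \<noteq> x" if "x \<in># proots p" for x using that assms(2) by auto
  have "poly (pderiv p) z = poly (pderiv (\<Prod>x\<in>#proots p. [:-x, 1:])) z"
    using monic_eq_prod_mset[OF assms(1)] by simp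
  also have "\<dots> = (\<Prod>x\<in>#proots p. z - x) * log_deriv p z"
    unfolding log_deriv_def using ne by (rule poly_pderiv_prod_mset_linear)
  also have "(\<Prod>x\<in>#proots p. z - x) = poly p z"
    using monic_eq_prod_mset[OF assms(1)] by (metis poly_prod_mset_linear)
  finally show ?thesis .
qed

lemma ln_cmod_prod_mset:
  "(\<And>x. x \<in># A \<Longrightarrow> z \<noteq> x) \<Longrightarrow> ln (cmod (\<Prod>x\<in>#A. z - x)) = (\<Sum>x\<in>#A. ln (cmod (z - x)))"
proof (induction A)
  case (add a A)
  have "(\<Prod>x\<in>#A. z - x) \<noteq> 0" using add.prems by (auto simp: prod_mset_zero_iff)
  thus ?case using add by (simp add: norm_mult ln_mult)
qed auto

lemma ln_cmod_poly:
  assumes "poly p z \<noteq> 0"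
  shows "ln (cmod (poly p z)) = ln (cmod (lead_coeff p)) + (\<Sum>x\<in>#proots p. ln (cmod (z - x)))"
proof -
  have "p \<noteq> 0" using assms by auto
  hence ne: "z \<noteq> x" if "x \<in># proots p" for x using that assms by auto
  have "poly p z = poly (smult (lead_coeff p) (\<Prod>x\<in>#proots p. [:-x, 1:])) z"
    by (simp only: complex_poly_decompose_multiset)
  hence eq: "poly p z = lead_coeff p * (\<Prod>x\<in>#proots p. z - x)"
    by (simp only: poly_smult poly_prod_mset_linear)
  hence "(\<Prod>x\<in>#proots p. z - x) \<noteq> 0" using assms by auto
  moreover have "ln (cmod (\<Prod>x\<in>#proots p. z - x)) = (\<Sum>x\<in>#proots p. ln (cmod (z - x)))"
    using ne by (rule ln_cmod_prod_mset)
  ultimately show ?thesis using \<open>p \<noteq> 0\<close> by (subst eq) (simp add: norm_mult ln_mult)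
qed

text \<open>Take logarithms in p' = p L. The term ln n is the leading coefficient of p', since p is
  monic.\<close>

lemma ln_cmod_log_deriv:
  assumes p: "lead_coeff p = 1" "degree p \<ge> 1" and z: "poly p z \<noteq> 0" "poly (pderiv p) z \<noteq> 0"
  shows "ln (cmod (log_deriv p z)) = ln (real (degree p))
    + (\<Sum>y\<in>#proots (pderiv p). ln (cmod (z - y))) - (\<Sum>x\<in>#proots p. ln (cmod (z - x)))"
proof -
  have lc: "lead_coeff (pderiv p) = of_nat (degree p)"
    using p by (simp add: degree_pderiv coeff_pderiv Suc_diff_le)
  have eq: "poly (pderiv p) z = poly p z * log_deriv p z"
    by (rule poly_pderiv_eq_log_deriv) fact+
  hence "log_deriv p z \<noteq> 0" using z by auto
  hence "ln (cmod (poly (pderiv p) z)) = ln (cmod (poly p z)) + ln (cmod (log_deriv p z))"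
    using z by (simp add: eq norm_mult ln_mult)
  thus ?thesis
    using p z by (simp add: ln_cmod_poly lc)
qed

lemma AE_poly_nonzero:
  assumes "p \<noteq> 0" shows "AE z in lborel. poly p (z::complex) \<noteq> 0"
proof -
  have "{z. poly p z = 0} \<in> null_sets lborel"
    using poly_roots_finite[OF assms] by (intro finite_imp_null_set_lborel)
  from AE_not_in[OF this] show ?thesis by simp
qed

lemma set_integrable_sum_mset:
  fixes h :: "'b \<Rightarrow> 'a \<Rightarrow> real"
  shows "(\<And>x. x \<in># A \<Longrightarrow> set_integrable M S (h x)) \<Longrightarrow> set_integrable M S (\<lambda>z. \<Sum>x\<in>#A. h x z)"
  by (induction A) (auto intro!: set_integral_add simp: set_integrable_def[of _ _ "\<lambda>_. 0"])

lemma set_integral_sum_mset: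
  fixes h :: "'b \<Rightarrow> 'a \<Rightarrow> real"
  shows "(\<And>x. x \<in># A \<Longrightarrow> set_integrable M S (h x)) \<Longrightarrow>
     (LINT z:S|M. \<Sum>x\<in>#A. h x z) = (\<Sum>x\<in>#A. LINT z:S|M. h x z)"
  by (induction A) (auto simp: set_integral_add set_integrable_sum_mset)

lemma set_integral_subset_mono:
  fixes f :: "'a \<Rightarrow> real"
  assumes "set_integrable M B f" "A \<in> sets M" "A \<subseteq> B" "\<And>x. x \<in> B \<Longrightarrow> 0 \<le> f x"
  shows "(LINT x:A|M. f x) \<le> (LINT x:B|M. f x)"
  using assms set_integrable_subset[OF assms(1-3)] unfolding set_lebesgue_integral_def set_integrable_def
  by (intro integral_mono) (auto simp: indicator_def)

lemma borel_measurable_sum_mset: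
  fixes h :: "'b \<Rightarrow> 'a \<Rightarrow> 'c::{second_countable_topology, real_normed_vector}"
  shows "(\<And>x. h x \<in> borel_measurable M) \<Longrightarrow> (\<lambda>z. \<Sum>x\<in>#A. h x z) \<in> borel_measurable M"
  by (induction A) auto

lemma borel_measurable_log_deriv [measurable]: "log_deriv p \<in> borel_measurable borel"
proof -
  have "(\<lambda>z. \<Sum>x\<in>#proots p. inverse (z - x)) \<in> borel_measurable borel"
    by (rule borel_measurable_sum_mset) measurable
  thus ?thesis by (simp add: log_deriv_def[abs_def])
qed

lemma pderiv_neq_0: "degree (p :: complex poly) \<ge> 1 \<Longrightarrow> pderiv p \<noteq> 0"
  by (simp add: pderiv_eq_0_iff)

lemma AE_ln_cmod_log_deriv:
  assumes p: "lead_coeff p = 1" "degree p \<ge> 1"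
  shows "AE z in lborel. ln (cmod (log_deriv p z)) = ln (real (degree p))
    + (\<Sum>y\<in>#proots (pderiv p). ln (cmod (z - y))) - (\<Sum>x\<in>#proots p. ln (cmod (z - x)))"
proof -
  have "p \<noteq> 0" using p by auto
  from AE_poly_nonzero[OF this] AE_poly_nonzero[OF pderiv_neq_0[OF p(2)]]
  show ?thesis by eventually_elim (use ln_cmod_log_deriv[OF p] in auto)
qed

lemma set_integrable_ln_log_deriv:
  assumes p: "lead_coeff p = 1" "degree p \<ge> 1"
  shows "set_integrable lborel (cball 0 R) (\<lambda>z. ln (cmod (log_deriv p z)))"
proof -
  have c: "set_integrable lborel (cball 0 R) (\<lambda>z::complex. ln (real (degree p)))"
    unfolding set_integrable_def by (intro borel_integrable_compact continuous_intros) auto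
  have "set_integrable lborel (cball 0 R) (\<lambda>z. ln (real (degree p))
    + (\<Sum>y\<in>#proots (pderiv p). ln (cmod (z - y))) - (\<Sum>x\<in>#proots p. ln (cmod (z - x))))"
    by (intro set_integral_add set_integral_diff set_integrable_sum_mset set_integrable_ln_dist c)
  moreover have "(\<lambda>z. indicator (cball 0 R) z *\<^sub>R ln (cmod (log_deriv p z))) \<in> borel_measurable lborel"
    by measurable
  ultimately show ?thesis unfolding set_integrable_def
    by (elim integrable_cong_AE_imp) (use AE_ln_cmod_log_deriv[OF p] in auto)
qed

section \<open>Critical points against roots\<close>

definition circle_mean :: "(complex \<Rightarrow> real) \<Rightarrow> real \<Rightarrow> complex \<Rightarrow> real" where
  "circle_mean f s z = (LINT t:{0..1}|lborel. f (z - of_real s * cis (2 * pi * t)))"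

lemma borel_measurable_circle [measurable]:
  "(\<lambda>t. complex_of_real s * cis (2 * pi * t)) \<in> borel_measurable borel"
  by (intro borel_measurable_continuous_onI continuous_intros)

lemma borel_measurable_circle_mean [measurable]:
  assumes [measurable]: "f \<in> borel_measurable borel"
  shows "circle_mean f s \<in> borel_measurable borel"
  unfolding circle_mean_def[abs_def] set_lebesgue_integral_def
  by (rule lborel.borel_measurable_lebesgue_integral) measurable

lemma abs_circle_mean_le:
  assumes f: "continuous_on UNIV f" and supp: "\<And>z. cmod z > \<rho> \<Longrightarrow> f z = 0"
    and B: "\<And>z. \<bar>f z\<bar> \<le> B" and s: "s > 0"
  shows "\<bar>circle_mean f s z\<bar> \<le> B * indicator (cball 0 (\<rho> + s)) z"
proof -
  have "\<bar>circle_mean f s z\<bar> \<le> (LINT t:{0..1::real}|lborel. \<bar>f (z - of_real s * cis (2 * pi * t))\<bar>)"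
    unfolding circle_mean_def real_norm_def[symmetric]
    by (intro set_integral_norm_bound borel_integrable_atLeastAtMost' continuous_on_compose2[OF f] continuous_intros) auto
  also have "\<dots> \<le> (LINT t:{0..1::real}|lborel. B * indicator (cball 0 (\<rho> + s)) z)"
  proof (rule set_integral_mono)
    fix t :: real
    show "\<bar>f (z - of_real s * cis (2 * pi * t))\<bar> \<le> B * indicator (cball 0 (\<rho> + s)) z"
    proof (cases "cmod z \<le> \<rho> + s")
      case False
      have "cmod z - cmod (of_real s * cis (2 * pi * t)) \<le> cmod (z - of_real s * cis (2 * pi * t))"
        by (rule norm_triangle_ineq2)
      hence "cmod (z - of_real s * cis (2 * pi * t)) > \<rho>" using False s by (simp add: norm_mult)
      thus ?thesis using False by (simp add: supp)
    qed (use B in auto)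
  qed (intro borel_integrable_atLeastAtMost' continuous_on_compose2[OF f] continuous_intros; auto)+
  also have "\<dots> = B * indicator (cball 0 (\<rho> + s)) z"
    by (simp add: set_lebesgue_integral_def)
  finally show ?thesis .
qed

lemma integrable_indicator_cball_ln_dist:
  "integrable lborel (\<lambda>z. indicator (cball 0 R) z * \<bar>ln (cmod (z - a))\<bar>)"
  using set_integrable_abs[OF set_integrable_ln_dist[of R a]] by (simp add: set_integrable_def)

text \<open>Averaging Jensen's formula over the centres replaces circle integrals, which see the
  logarithmic singularities badly, by an area integral.\<close>

lemma circle_mean_ln:
  fixes f :: "complex \<Rightarrow> real"
  assumes f: "continuous_on UNIV f" and supp: "\<And>z. cmod z > \<rho> \<Longrightarrow> f z = 0"
    and B: "\<And>z. \<bar>f z\<bar> \<le> B" and s: "s > 0"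
  shows "integrable lborel (\<lambda>z. circle_mean f s z * ln (cmod (z - a)))"
    and "(\<integral>z. circle_mean f s z * ln (cmod (z - a)) \<partial>lborel)
       = (\<integral>w. f w * ln (max s (cmod (w - a))) \<partial>lborel)"
proof -
  have fm [measurable]: "f \<in> borel_measurable borel" using f by (rule borel_measurable_continuous_onI)
  define e where "e = (\<lambda>t. complex_of_real s * cis (2 * pi * t))"
  have [measurable]: "e \<in> borel_measurable borel" unfolding e_def by measurable
  define h where "h = (\<lambda>z t. indicator {0..1} t * f (z - e t) * ln (cmod (z - a)))"
  define k where "k = (\<lambda>w t. indicator {0..1} t * f w * ln (cmod (w + e t - a)))"
  have hk: "h (w + e t) t = k w t" for w t by (simp add: h_def k_def)
  have cm: "circle_mean f s z = (\<integral>t. indicator {0..1} t * f (z - e t) \<partial>lborel)" for z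
    by (simp add: circle_mean_def set_lebesgue_integral_def e_def)
  have cm_abs: "circle_mean (\<lambda>z. \<bar>f z\<bar>) s z = (\<integral>t. indicator {0..1} t * \<bar>f (z - e t)\<bar> \<partial>lborel)" for z
    by (simp add: circle_mean_def set_lebesgue_integral_def e_def)
  have absf: "continuous_on UNIV (\<lambda>z. \<bar>f z\<bar>)" using f by (intro continuous_intros)
  have [measurable]: "(\<lambda>(z, t). h z t) \<in> borel_measurable (lborel \<Otimes>\<^sub>M lborel)"
    unfolding h_def by measurable
  have [measurable]: "(\<lambda>(t, w). k w t) \<in> borel_measurable (lborel \<Otimes>\<^sub>M lborel)"
    unfolding k_def by measurable
  \<comment> \<open>The logarithm does not involve t, so the inner integral of |h| is a circle mean
    of |f| times |ln|; that mean is bounded with compact support, and ln is integrable on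
    discs.\<close>
  have int_h: "integrable (lborel \<Otimes>\<^sub>M lborel) (\<lambda>(z, t). h z t)"
  proof (rule lborel_pair.Fubini_integrable)
    have norm_eq: "(\<integral>t. \<bar>h z t\<bar> \<partial>lborel) = circle_mean (\<lambda>z. \<bar>f z\<bar>) s z * \<bar>ln (cmod (z - a))\<bar>" for z
      unfolding cm_abs h_def by (subst integral_mult_left_zero[symmetric])
        (auto simp: abs_mult intro!: Bochner_Integration.integral_cong)
    have "integrable lborel (\<lambda>z. B * (indicator (cball 0 (\<rho> + s)) z * \<bar>ln (cmod (z - a))\<bar>))"
      by (intro integrable_mult_right integrable_indicator_cball_ln_dist)
    hence "integrable lborel (\<lambda>z. circle_mean (\<lambda>z. \<bar>f z\<bar>) s z * \<bar>ln (cmod (z - a))\<bar>)"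
    proof (rule Bochner_Integration.integrable_bound)
      have "\<bar>circle_mean (\<lambda>z. \<bar>f z\<bar>) s z\<bar> \<le> B * indicator (cball 0 (\<rho> + s)) z" for z
        by (rule abs_circle_mean_le[OF absf]) (use supp B s in auto)
      hence "\<bar>circle_mean (\<lambda>z. \<bar>f z\<bar>) s z\<bar> * \<bar>ln (cmod (z - a))\<bar>
           \<le> \<bar>B * (indicator (cball 0 (\<rho> + s)) z * \<bar>ln (cmod (z - a))\<bar>)\<bar>" for z
        using mult_right_mono[of "\<bar>circle_mean (\<lambda>z. \<bar>f z\<bar>) s z\<bar>" "B * indicator (cball 0 (\<rho> + s)) z" "\<bar>ln (cmod (z - a))\<bar>"]
        by (intro order_trans[OF _ abs_ge_self]) (simp add: mult_ac)
      thus "AE z in lborel. norm (circle_mean (\<lambda>z. \<bar>f z\<bar>) s z * \<bar>ln (cmod (z - a))\<bar>)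
          \<le> norm (B * (indicator (cball 0 (\<rho> + s)) z * \<bar>ln (cmod (z - a))\<bar>))"
        by (auto simp: abs_mult)
    qed measurable
    thus "integrable lborel (\<lambda>z. \<integral>t. norm (case (z, t) of (z, t) \<Rightarrow> h z t) \<partial>lborel)"
      by (simp add: norm_eq)
    have "integrable lborel (\<lambda>t. h z t)" for z
    proof -
      have "set_integrable lborel {0..1} (\<lambda>t. f (z - e t) * ln (cmod (z - a)))"
        unfolding e_def
        by (intro borel_integrable_atLeastAtMost' continuous_intros continuous_on_compose2[OF f]) auto
      thus ?thesis by (simp add: set_integrable_def h_def mult_ac)
    qed
    thus "AE z in lborel. integrable lborel (\<lambda>t. case (z, t) of (z, t) \<Rightarrow> h z t)" by simp
  qed measurable
  have inner_h: "(\<integral>t. h z t \<partial>lborel) = circle_mean f s z * ln (cmod (z - a))" for z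
    unfolding cm h_def by simp
  show "integrable lborel (\<lambda>z. circle_mean f s z * ln (cmod (z - a)))"
    using lborel_pair.integrable_fst[OF int_h] by (simp add: inner_h)

  \<comment> \<open>Integrability of \<open>k\<close> is inherited from \<open>h\<close>: for fixed
    t the two differ by the translation by \<open>e t\<close>, which preserves the integral of the
    absolute value.\<close>
  have int_k: "integrable (lborel \<Otimes>\<^sub>M lborel) (\<lambda>(t, w). k w t)"
  proof (rule lborel_pair.Fubini_integrable)
    have "integrable (lborel \<Otimes>\<^sub>M lborel) (\<lambda>(z, t). \<bar>h z t\<bar>)"
      using integrable_abs[OF int_h] by (simp add: case_prod_beta')
    from lborel_pair.integrable_snd[OF this]
    have "integrable lborel (\<lambda>t. \<integral>z. \<bar>h z t\<bar> \<partial>lborel)" .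
    moreover have "(\<integral>z. \<bar>h z t\<bar> \<partial>lborel) = (\<integral>w. \<bar>k w t\<bar> \<partial>lborel)" for t
      unfolding hk[symmetric] by (rule integral_lborel_translate[symmetric])
    ultimately show "integrable lborel (\<lambda>t. \<integral>w. norm (case (t, w) of (t, w) \<Rightarrow> k w t) \<partial>lborel)"
      by simp
    show "AE t in lborel. integrable lborel (\<lambda>w. case (t, w) of (t, w) \<Rightarrow> k w t)"
      using lborel_pair.AE_integrable_snd[OF int_h]
    proof eventually_elim
      case (elim t)
      thus ?case using integrable_lborel_translate_iff[of "\<lambda>z. h z t" "e t"] by (simp add: hk)
    qed
  qed measurable

  \<comment> \<open>Swap, translate z to w + e(t), and swap back: the circle moves from f to the
    logarithm, where Jensen's formula evaluates the t-integral for almost every w.\<close>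
  have "(\<integral>z. circle_mean f s z * ln (cmod (z - a)) \<partial>lborel) = (\<integral>z. (\<integral>t. h z t \<partial>lborel) \<partial>lborel)"
    by (simp add: inner_h)
  also have "\<dots> = (\<integral>t. (\<integral>z. h z t \<partial>lborel) \<partial>lborel)"
    by (rule lborel_pair.Fubini_integral[OF int_h, symmetric])
  also have "\<dots> = (\<integral>t. (\<integral>w. k w t \<partial>lborel) \<partial>lborel)"
    unfolding hk[symmetric]
    by (subst integral_lborel_translate[of "\<lambda>z. h z t" "e t" for t]) (rule refl)
  also have "\<dots> = (\<integral>w. (\<integral>t. k w t \<partial>lborel) \<partial>lborel)"
    by (rule lborel_pair.Fubini_integral[OF int_k, symmetric])
  also have "\<dots> = (\<integral>w. f w * ln (max s (cmod (w - a))) \<partial>lborel)"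
  proof (rule integral_cong_AE)
    \<comment> \<open>The centres w at distance exactly s from a, which the circle formula excludes,
      form a null set.\<close>
    have "sphere a s \<in> null_sets lborel"
      using negligible_sphere[of a s] by (simp add: negligible_iff_null_sets null_sets_completion_iff)
    from AE_not_in[OF this]
    show "AE w in lborel. (\<integral>t. k w t \<partial>lborel) = f w * ln (max s (cmod (w - a)))"
    proof eventually_elim
      case (elim w)
      hence ne: "cmod (a - w) \<noteq> s" by (simp add: dist_norm)
      have nz: "a - w - of_real s * cis (2 * pi * t) \<noteq> 0" for t
      proof
        assume "a - w - of_real s * cis (2 * pi * t) = 0"
        hence "cmod (a - w) = cmod (of_real s * cis (2 * pi * t))" by simp
        thus False using ne s by (simp add: norm_mult)
      qed
      have si: "set_integrable lborel {0..1} (\<lambda>t. ln (cmod (a - w - of_real s * cis (2 * pi * t))))"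
        by (intro borel_integrable_atLeastAtMost' continuous_intros) (use nz in auto)
      have "k w t = indicator {0..1} t *\<^sub>R (f w * ln (cmod (a - w - of_real s * cis (2 * pi * t))))" for t
        using norm_minus_commute[of "w + e t" a] by (simp add: k_def e_def algebra_simps)
      hence "(\<integral>t. k w t \<partial>lborel) = (LINT t:{0..1}|lborel. f w * ln (cmod (a - w - of_real s * cis (2 * pi * t))))"
        by (simp only: set_lebesgue_integral_def)
      also have "\<dots> = f w * (LINT t:{0..1}|lborel. ln (cmod (a - w - of_real s * cis (2 * pi * t))))"
        by (rule set_integral_mult_right)
      also have "(LINT t:{0..1}|lborel. ln (cmod (a - w - of_real s * cis (2 * pi * t)))) = ln (max s (cmod (a - w)))"
        using set_borel_integral_eq_integral(2)[OF si] integral_unique[OF has_integral_ln_circle[OF s ne]] by simp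
      finally show ?case by (simp add: norm_minus_commute)
    qed
    show "(\<lambda>w. \<integral>t. k w t \<partial>lborel) \<in> borel_measurable lborel"
      by (rule lborel.borel_measurable_lebesgue_integral) (simp add: k_def)
  qed measurable
  finally show "(\<integral>z. circle_mean f s z * ln (cmod (z - a)) \<partial>lborel)
       = (\<integral>w. f w * ln (max s (cmod (w - a))) \<partial>lborel)" .
qed


text \<open>The difference of the two Jensen kernels, centred at a, is a nonnegative bump supported
  in the disc of radius s, with total mass c. Integrating f against it returns c * f a up to c times
  the oscillation of f on scale s. The subtraction is what removes the growth of ln at
  infinity.\<close>

lemma log_tent_approximation:
  fixes f :: "complex \<Rightarrow> real"
  assumes f: "continuous_on UNIV f" and supp: "\<And>z. cmod z > \<rho> \<Longrightarrow> f z = 0"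
    and r: "0 < r" "r < s" and mod: "\<And>w z. cmod (w - z) \<le> s \<Longrightarrow> \<bar>f w - f z\<bar> \<le> \<eta>"
  defines "c \<equiv> \<integral>u. ln (max s (cmod u)) - ln (max r (cmod u)) \<partial>lborel"
  shows "c > 0"
    and "\<bar>(\<integral>w. f w * ln (max s (cmod (w - a))) \<partial>lborel)
       - (\<integral>w. f w * ln (max r (cmod (w - a))) \<partial>lborel) - c * f a\<bar> \<le> c * \<eta>"
proof -
  define T where "T = (\<lambda>u. ln (max s (cmod u)) - ln (max r (cmod u)))"
  have c: "c = (\<integral>u. T u \<partial>lborel)" by (simp add: c_def T_def)
  have T0: "T u \<ge> 0" for u using r by (simp add: T_def)
  have Tsupp: "T u = 0" if "cmod u > s" for u using that r by (simp add: T_def max_def)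
  have "integrable lborel (\<lambda>u. indicator (cball 0 s) u *\<^sub>R T u)"
    unfolding T_def by (intro borel_integrable_compact continuous_intros) (use r in auto)
  also have "(\<lambda>u. indicator (cball 0 s) u *\<^sub>R T u) = T"
    using Tsupp by (auto simp: indicator_def fun_eq_iff)
  finally have Tint: "integrable lborel T" .
  \<comment> \<open>On the inner disc of radius r the bump is constantly ln (s / r) > 0, so its mass
    is positive.\<close>
  have "0 < ln (s / r) * measure lborel (ball (0::complex) r)"
    using r by (intro mult_pos_pos) (auto simp: content_ball)
  also have "\<dots> = (\<integral>u. ln (s / r) * indicator (ball (0::complex) r) u \<partial>lborel)" by simp
  also have "\<dots> \<le> (\<integral>u. T u \<partial>lborel)"
  proof (rule integral_mono)
    have "emeasure lborel (ball (0::complex) r) < \<infinity>" by (rule emeasure_bounded_finite) simp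
    thus "integrable lborel (\<lambda>u. ln (s / r) * indicat_real (ball (0::complex) r) u)"
      by (intro integrable_mult_right integrable_real_indicator) auto
    show "ln (s / r) * indicat_real (ball 0 r) u \<le> T u" for u
    proof (cases "u \<in> ball 0 r")
      case True
      thus ?thesis using r by (simp add: T_def ln_div max_def)
    qed (use T0 in auto)
  qed (rule Tint)
  finally show "c > 0" by (simp add: c)

  have Ta: "integrable lborel (\<lambda>w. T (w - a))" "(\<integral>w. T (w - a) \<partial>lborel) = c"
    using integrable_lborel_translate_iff[of T "-a"] integral_lborel_translate[of T "-a"] Tint
    by (auto simp: c)
  have fint: "integrable lborel (\<lambda>w. f w * ln (max q (cmod (w - a))))" if "q > 0" for q
  proof -
    have "integrable lborel (\<lambda>w. indicator (cball 0 \<rho>) w *\<^sub>R (f w * ln (max q (cmod (w - a)))))"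
      by (intro borel_integrable_compact continuous_intros continuous_on_subset[OF f]) (use that in auto)
    also have "(\<lambda>w. indicator (cball 0 \<rho>) w *\<^sub>R (f w * ln (max q (cmod (w - a)))))
        = (\<lambda>w. f w * ln (max q (cmod (w - a))))"
      using supp by (auto simp: indicator_def fun_eq_iff)
    finally show ?thesis .
  qed
  have fT: "integrable lborel (\<lambda>w. f w * T (w - a))"
    using Bochner_Integration.integrable_diff[OF fint[of s] fint[of r]] r by (simp add: T_def right_diff_distrib)
  have "(\<integral>w. f w * ln (max s (cmod (w - a))) \<partial>lborel)
       - (\<integral>w. f w * ln (max r (cmod (w - a))) \<partial>lborel) - c * f a
     = (\<integral>w. f w * T (w - a) \<partial>lborel) - (\<integral>w. f a * T (w - a) \<partial>lborel)"
  proof -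
    have "(\<integral>w. f a * T (w - a) \<partial>lborel) = c * f a" using Ta by simp
    moreover have "(\<integral>w. f w * T (w - a) \<partial>lborel) = (\<integral>w. f w * ln (max s (cmod (w - a))) \<partial>lborel)
       - (\<integral>w. f w * ln (max r (cmod (w - a))) \<partial>lborel)"
      using fint[of s] fint[of r] r by (simp add: T_def right_diff_distrib)
    ultimately show ?thesis by linarith
  qed
  also have "\<dots> = (\<integral>w. (f w - f a) * T (w - a) \<partial>lborel)"
    using fT Ta by (simp add: left_diff_distrib)
  also have "\<bar>\<dots>\<bar> \<le> (\<integral>w. \<bar>(f w - f a) * T (w - a)\<bar> \<partial>lborel)"
    by (rule integral_abs_bound)
  also have "\<dots> \<le> (\<integral>w. \<eta> * T (w - a) \<partial>lborel)"
  proof (rule integral_mono)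
    show "integrable lborel (\<lambda>w. \<bar>(f w - f a) * T (w - a)\<bar>)"
      using fT Ta by (intro integrable_abs) (simp add: left_diff_distrib)
    show "\<bar>(f w - f a) * T (w - a)\<bar> \<le> \<eta> * T (w - a)" for w
    proof (cases "cmod (w - a) \<le> s")
      case True
      thus ?thesis using mod[OF True] T0[of "w - a"] by (simp add: abs_mult mult_right_mono)
    qed (use Tsupp[of "w - a"] in auto)
  qed (use Ta in auto)
  also have "\<dots> = c * \<eta>" using Ta by simp
  finally show "\<bar>(\<integral>w. f w * ln (max s (cmod (w - a))) \<partial>lborel)
       - (\<integral>w. f w * ln (max r (cmod (w - a))) \<partial>lborel) - c * f a\<bar> \<le> c * \<eta>" .
qed

lemma compact_support_uniform_modulus:
  fixes f :: "complex \<Rightarrow> real"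
  assumes f: "continuous_on UNIV f" and supp: "\<And>z. cmod z > \<rho> \<Longrightarrow> f z = 0" and \<eta>: "\<eta> > 0"
  obtains s where "s > 0" "\<And>w z. cmod (w - z) \<le> s \<Longrightarrow> \<bar>f w - f z\<bar> \<le> \<eta>"
proof -
  have "uniformly_continuous_on (cball 0 (\<rho> + 1)) f"
    by (intro compact_uniformly_continuous continuous_on_subset[OF f]) auto
  then obtain d where d: "d > 0" "\<And>w z. w \<in> cball 0 (\<rho> + 1) \<Longrightarrow> z \<in> cball 0 (\<rho> + 1) \<Longrightarrow>
      dist w z < d \<Longrightarrow> dist (f w) (f z) < \<eta>"
    using \<eta> unfolding uniformly_continuous_on_def by (metis dist_commute)
  \<comment> \<open>Distance at most 1 keeps both points in the enlarged disc as soon as one lies in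
    the smaller; if neither does, both values vanish. Halving d makes the distance strictly less
    than d.\<close>
  have "\<bar>f w - f z\<bar> \<le> \<eta>" if wz: "cmod (w - z) \<le> min 1 (d / 2)" for w z
  proof (cases "cmod w \<le> \<rho> \<or> cmod z \<le> \<rho>")
    case True
    have "cmod w \<le> cmod z + cmod (w - z)" "cmod z \<le> cmod w + cmod (w - z)"
      using norm_triangle_ineq[of z "w - z"] norm_triangle_ineq4[of w "w - z"] by auto
    hence "cmod w \<le> \<rho> + 1" "cmod z \<le> \<rho> + 1" using True wz by auto
    moreover have "dist w z < d" using wz d by (auto simp: dist_norm)
    ultimately have "dist (f w) (f z) < \<eta>" by (intro d) auto
    thus ?thesis by (simp add: dist_real_def)
  qed (use \<eta> supp in auto)
  thus ?thesis using d by (intro that[of "min 1 (d / 2)"]) auto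
qed

lemma integrable_mult_sum_mset:
  fixes h :: "'b \<Rightarrow> 'a \<Rightarrow> real"
  assumes "\<And>x. integrable M (\<lambda>z. G z * h x z)"
  shows "integrable M (\<lambda>z. G z * (\<Sum>x\<in>#A. h x z))"
    and "(\<integral>z. G z * (\<Sum>x\<in>#A. h x z) \<partial>M) = (\<Sum>x\<in>#A. \<integral>z. G z * h x z \<partial>M)"
proof -
  show 1: "integrable M (\<lambda>z. G z * (\<Sum>x\<in>#A. h x z))" for A
    by (induction A) (use assms in \<open>auto simp: ring_distribs\<close>)
  show "(\<integral>z. G z * (\<Sum>x\<in>#A. h x z) \<partial>M) = (\<Sum>x\<in>#A. \<integral>z. G z * h x z \<partial>M)"
    by (induction A) (use assms 1 in \<open>auto simp: ring_distribs\<close>)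
qed

text \<open>The kernel \<open>G\<close>, a difference of circle means at radii s and r, integrates
  against ln |z - a| to approximately c * f a. Summing over the zeros of p' and subtracting the sum
  over the roots of p leaves \<open>G\<close> integrated against ln |L| - ln n. The n roots and the
  at most n critical points each carry an error of at most c * \<eta>, hence the 2 * \<eta>. The
  witnesses depend on f and \<eta> but not on p.\<close>

lemma critical_sum_minus_root_sum_le:
  fixes f :: "complex \<Rightarrow> real"
  assumes f: "continuous_on UNIV f" and supp: "\<And>z. cmod z > \<rho> \<Longrightarrow> f z = 0" and \<eta>: "\<eta> > 0"
  obtains R C where "R > 0" "C \<ge> 0"
    "\<And>p. lead_coeff p = 1 \<Longrightarrow> degree p \<ge> 1 \<Longrightarrow>
      \<bar>(\<Sum>y\<in>#proots (pderiv p). f y) - (\<Sum>x\<in>#proots p. f x)\<bar>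
        \<le> 2 * \<eta> * real (degree p)
          + C * ((LINT z:cball 0 R|lborel. \<bar>ln (cmod (log_deriv p z))\<bar>) + ln (real (degree p)))"
proof -
  have [measurable]: "f \<in> borel_measurable borel" using f by (rule borel_measurable_continuous_onI)
  obtain s where s: "s > 0" "\<And>w z. cmod (w - z) \<le> s \<Longrightarrow> \<bar>f w - f z\<bar> \<le> \<eta>"
    using compact_support_uniform_modulus[OF f supp \<eta>] by metis
  have "bounded (f ` cball 0 \<rho>)"
    by (intro compact_imp_bounded compact_continuous_image continuous_on_subset[OF f]) auto
  then obtain B where "\<And>z. z \<in> cball 0 \<rho> \<Longrightarrow> \<bar>f z\<bar> \<le> B"
    unfolding bounded_iff by (metis imageI real_norm_def)
  \<comment> \<open>The maximum with 0 covers the points outside the support, and also negative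
    \<rho>, where the disc is empty and B arbitrary.\<close>
  hence B: "\<bar>f z\<bar> \<le> max 0 B" for z using supp[of z] by (cases "cmod z \<le> \<rho>") force+
  define b where "b = max 0 B"
  have b: "b \<ge> 0" "\<And>z. \<bar>f z\<bar> \<le> b" using B by (auto simp: b_def)
  define r where "r = s / 2"
  have r: "0 < r" "r < s" using s by (auto simp: r_def)
  define c where "c = (\<integral>u. ln (max s (cmod u)) - ln (max r (cmod u)) \<partial>lborel)"
  have c: "c > 0" unfolding c_def by (rule log_tent_approximation[OF f supp r s(2)])
  define R where "R = \<bar>\<rho>\<bar> + s"
  have R: "R > 0" using s by (simp add: R_def)
  define v where "v = measure lborel (cball (0::complex) R)"
  define G where "G = (\<lambda>z. circle_mean f s z - circle_mean f r z)"
  have [measurable]: "G \<in> borel_measurable borel" unfolding G_def by measurable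
  have G: "\<bar>G z\<bar> \<le> 2 * b * indicator (cball 0 R) z" for z
  proof -
    have "\<bar>circle_mean f q z\<bar> \<le> b * indicator (cball 0 R) z" if "q > 0" "q \<le> s" for q
    proof -
      have "\<bar>circle_mean f q z\<bar> \<le> b * indicator (cball 0 (\<rho> + q)) z"
        by (rule abs_circle_mean_le[OF f supp b(2)]) (use that in auto)
      also have "\<dots> \<le> b * indicator (cball 0 R) z"
        using b that by (intro mult_left_mono) (auto simp: indicator_def R_def)
      finally show ?thesis .
    qed
    from this[of s] this[of r] show ?thesis using r s unfolding G_def by linarith
  qed
  define J where "J = (\<lambda>a. \<integral>z. G z * ln (cmod (z - a)) \<partial>lborel)"
  have GI: "integrable lborel (\<lambda>z. G z * ln (cmod (z - a)))" for a
    using circle_mean_ln(1)[OF f supp b(2)] r s by (simp add: G_def left_diff_distrib)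
  have J: "\<bar>J a - c * f a\<bar> \<le> c * \<eta>" for a
  proof -
    have "J a = (\<integral>w. f w * ln (max s (cmod (w - a))) \<partial>lborel) - (\<integral>w. f w * ln (max r (cmod (w - a))) \<partial>lborel)"
      using circle_mean_ln[OF f supp b(2)] r s by (simp add: J_def G_def left_diff_distrib)
    thus ?thesis using log_tent_approximation(2)[OF f supp r s(2)] by (simp add: c_def)
  qed
  have JA: "\<bar>(\<Sum>a\<in>#A. J a) - c * (\<Sum>a\<in>#A. f a)\<bar> \<le> real (size A) * (c * \<eta>)" for A
  proof (induction A)
    case (add a A)
    thus ?case using J[of a] by (simp add: ring_distribs abs_le_iff)
  qed auto
  \<comment> \<open>Here 2 * b bounds |G|, the area v of the disc accounts for the constant ln n,
    and dividing by c normalises the bump to unit mass.\<close>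
  define C where "C = 2 * b * (1 + v) / c"
  have bound: "\<bar>(\<Sum>y\<in>#proots (pderiv p). f y) - (\<Sum>x\<in>#proots p. f x)\<bar>
        \<le> 2 * \<eta> * real (degree p)
          + C * ((LINT z:cball 0 R|lborel. \<bar>ln (cmod (log_deriv p z))\<bar>) + ln (real (degree p)))"
    if p: "lead_coeff p = 1" "degree p \<ge> 1" for p
  proof -
    define n where "n = real (degree p)"
    have n: "n \<ge> 1" using p by (simp add: n_def)
    define A where "A = proots p"
    define D where "D = proots (pderiv p)"
    define L where "L = (\<lambda>z. ln (cmod (log_deriv p z)))"
    have [measurable]: "L \<in> borel_measurable borel" unfolding L_def by measurable
    define I where "I = (LINT z:cball 0 R|lborel. \<bar>L z\<bar>)"
    have iL: "integrable lborel (\<lambda>z. indicator (cball 0 R) z * \<bar>L z\<bar>)"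
      using set_integrable_abs[OF set_integrable_ln_log_deriv[OF p, of R]] by (simp add: L_def set_integrable_def)
    have iv: "integrable lborel (indicat_real (cball (0::complex) R))"
      by (rule integrable_real_indicator) (use emeasure_compact_finite[of "cball (0::complex) R"] in auto)
    note GS = integrable_mult_sum_mset[of lborel G "\<lambda>x z. ln (cmod (z - x))", OF GI]
    have "(\<Sum>a\<in>#D. J a) - (\<Sum>a\<in>#A. J a)
       = (\<integral>z. G z * (\<Sum>y\<in>#D. ln (cmod (z - y))) - G z * (\<Sum>x\<in>#A. ln (cmod (z - x))) \<partial>lborel)"
      unfolding J_def using GS by simp
    also have "\<dots> = (\<integral>z. G z * (L z - ln n) \<partial>lborel)"
    proof (rule integral_cong_AE)
      show "(\<lambda>z. G z * (\<Sum>y\<in>#D. ln (cmod (z - y))) - G z * (\<Sum>x\<in>#A. ln (cmod (z - x))))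
          \<in> borel_measurable lborel"
        using GS(1) by (intro borel_measurable_diff) auto
      show "AE z in lborel. G z * (\<Sum>y\<in>#D. ln (cmod (z - y))) - G z * (\<Sum>x\<in>#A. ln (cmod (z - x)))
          = G z * (L z - ln n)"
        using AE_ln_cmod_log_deriv[OF p]
      proof eventually_elim
        case (elim z)
        hence "L z - ln n = (\<Sum>y\<in>#D. ln (cmod (z - y))) - (\<Sum>x\<in>#A. ln (cmod (z - x)))"
          by (simp add: L_def n_def A_def D_def)
        thus ?case by (simp add: right_diff_distrib)
      qed
    qed measurable
    also have "\<bar>\<dots>\<bar> \<le> (\<integral>z. \<bar>G z * (L z - ln n)\<bar> \<partial>lborel)" by (rule integral_abs_bound)
    also have "\<dots> \<le> (\<integral>z. 2 * b * (indicator (cball 0 R) z * \<bar>L z\<bar>) + 2 * b * ln n * indicator (cball 0 R) z \<partial>lborel)"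
    proof (rule integral_mono_AE')
      show "integrable lborel (\<lambda>z. 2 * b * (indicator (cball 0 R) z * \<bar>L z\<bar>) + 2 * b * ln n * indicator (cball 0 R) z)"
        using iL iv by auto
      show "AE z in lborel. \<bar>G z * (L z - ln n)\<bar>
          \<le> 2 * b * (indicator (cball 0 R) z * \<bar>L z\<bar>) + 2 * b * ln n * indicator (cball 0 R) z"
      proof (rule AE_I2)
        fix z
        have "\<bar>G z * (L z - ln n)\<bar> = \<bar>G z\<bar> * \<bar>L z - ln n\<bar>" by (simp add: abs_mult)
        also have "\<dots> \<le> (2 * b * indicator (cball 0 R) z) * (\<bar>L z\<bar> + ln n)"
          using G[of z] ln_ge_zero[OF n] b by (intro mult_mono) auto
        finally show "\<bar>G z * (L z - ln n)\<bar>
          \<le> 2 * b * (indicator (cball 0 R) z * \<bar>L z\<bar>) + 2 * b * ln n * indicator (cball 0 R) z"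
          by (simp add: algebra_simps)
      qed
    qed (use b n in auto)
    also have "\<dots> = 2 * b * I + 2 * b * ln n * v"
      using iL iv by (simp add: I_def v_def set_lebesgue_integral_def)
    also have "\<dots> \<le> 2 * b * (1 + v) * (I + ln n)"
    proof -
      have "0 \<le> I" unfolding I_def set_lebesgue_integral_def by (intro Bochner_Integration.integral_nonneg) auto
      moreover have "0 \<le> ln n" "0 \<le> v" using n by (auto simp: v_def)
      ultimately have "0 \<le> b * (v * I + ln n)" using b by (intro mult_nonneg_nonneg add_nonneg_nonneg) auto
      thus ?thesis by (simp add: algebra_simps)
    qed
    finally have JJ: "\<bar>(\<Sum>a\<in>#D. J a) - (\<Sum>a\<in>#A. J a)\<bar> \<le> 2 * b * (1 + v) * (I + ln n)" .
    have sz: "real (size A) = n" "real (size D) \<le> n"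
      by (auto simp: A_def D_def n_def size_proots_complex degree_pderiv)
    have "c * \<bar>(\<Sum>y\<in>#D. f y) - (\<Sum>x\<in>#A. f x)\<bar> = \<bar>c * (\<Sum>y\<in>#D. f y) - c * (\<Sum>x\<in>#A. f x)\<bar>"
      using c by (simp add: abs_mult flip: right_diff_distrib)
    also have "\<dots> \<le> real (size D) * (c * \<eta>) + real (size A) * (c * \<eta>) + 2 * b * (1 + v) * (I + ln n)"
      using JA[of A] JA[of D] JJ by linarith
    also have "\<dots> \<le> n * (c * \<eta>) + n * (c * \<eta>) + 2 * b * (1 + v) * (I + ln n)"
      using sz c \<eta> by (intro add_right_mono add_mono mult_right_mono) auto
    also have "\<dots> = c * (2 * \<eta> * n + C * (I + ln n))"
      using c by (simp add: C_def field_simps)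
    finally show ?thesis
      using c by (simp add: n_def A_def D_def I_def L_def)
  qed
  show ?thesis
    by (rule that[OF R _ bound]) (use b c in \<open>auto simp: C_def v_def\<close>)
qed

section \<open>Mean size of the logarithmic derivative\<close>

text \<open>Centring at 0 the logarithms of the far points makes all of them bounded in L^2 of the disc,
  uniformly in y; the centring terms only contribute a constant.\<close>

definition centred_ln :: "real \<Rightarrow> complex \<Rightarrow> complex \<Rightarrow> real" where
  "centred_ln R y z = ln (cmod (z - y)) - (if cmod y \<le> 2 * R then 0 else ln (cmod y))"

lemma borel_measurable_centred_ln [measurable]: "centred_ln R y \<in> borel_measurable borel"
  unfolding centred_ln_def[abs_def] by measurable

lemma set_integrable_const_cball:
  "set_integrable lborel (cball (c :: 'a::euclidean_space) R) (\<lambda>_. b::real)"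
  unfolding set_integrable_def by (intro borel_integrable_compact continuous_intros) auto

lemma set_integrable_centred_ln: "set_integrable lborel (cball 0 R) (centred_ln R y)"
  unfolding centred_ln_def[abs_def]
  by (intro set_integral_diff set_integrable_ln_dist set_integrable_const_cball)

text \<open>The threshold 2 * R makes |z - y| / |y| lie in [1/2, 3/2] for far y and |z| <= R, so the
  centred logarithm has modulus at most 1. For near y, |z - y| <= 3 * R, and the factor 8 in the
  bound for the squared logarithm gives 24 * R.\<close>

lemma centred_ln_square_le:
  assumes R: "R > 0" and z: "cmod z \<le> R"
  shows "(centred_ln R y z)\<^sup>2 \<le> 8 * inverse (cmod (z - y)) + (24 * R + 1)"
proof (cases "cmod y \<le> 2 * R")
  case True
  have "cmod (z - y) \<le> 3 * R" using True z norm_triangle_ineq4[of z y] by linarith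
  thus ?thesis
    using True R ln_square_le_inverse_add[of "cmod (z - y)"] by (simp add: centred_ln_def)
next
  case False
  define t where "t = cmod (z - y) / cmod y"
  have y: "cmod y > 2 * R" "cmod y > 0" using False R by auto
  have "cmod (z - y) \<le> cmod z + cmod y" "cmod y - cmod z \<le> cmod (z - y)"
    using norm_triangle_ineq4[of z y] norm_triangle_ineq2[of y z] by (auto simp: norm_minus_commute)
  hence t: "1/2 \<le> t" "t \<le> 3/2" using z y by (auto simp: t_def field_simps)
  have zy: "cmod (z - y) > 0" using t y by (auto simp: t_def)
  have "centred_ln R y z = ln t" using False y zy by (simp add: centred_ln_def t_def ln_div)
  moreover have "\<bar>ln t\<bar> \<le> 1"
  proof -
    have "ln t \<le> t - 1" using t by (intro ln_le_minus_one) auto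
    moreover have "- ln t \<le> inverse t - 1"
      using ln_le_minus_one[of "inverse t"] t by (simp add: ln_inverse)
    moreover have "inverse t \<le> 2" using t by (simp add: field_simps)
    ultimately show ?thesis using t by auto
  qed
  ultimately have "(centred_ln R y z)\<^sup>2 \<le> 1" by (simp add: abs_square_le_1)
  moreover have "inverse (cmod (z - y)) \<ge> 0" by simp
  ultimately show ?thesis using R by linarith
qed

text \<open>With l the integrand, 2 l K <= l^2 + K^2 gives l <= l^2 / K + K pointwise, and the
  integral of l^2 over the disc is bounded uniformly in y. This takes the place of Cauchy-Schwarz;
  the free parameter K trades a small first term against the area of S.\<close>

lemma centred_ln_integral_bound:
  assumes R: "R > 0"
  obtains C where "C > 0"
    "\<And>S K y. S \<in> sets borel \<Longrightarrow> S \<subseteq> cball 0 R \<Longrightarrow> K > 0 \<Longrightarrow>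
       (LINT z:S|lborel. \<bar>centred_ln R y z\<bar>) \<le> C / K + K * measure lborel S"
proof -
  obtain C0 where C0: "C0 > 0"
    "\<And>x. set_integrable lborel (cball 0 R) (\<lambda>z. inverse (cmod (z - x)))"
    "\<And>x. (LINT z:cball 0 R|lborel. inverse (cmod (z - x))) \<le> C0"
    using inverse_dist_integral_bound by metis
  define a where "a = measure lborel (cball (0::complex) R)"
  define b where "b = 24 * R + 1"
  have b: "b > 0" using R by (simp add: b_def)
  define C where "C = 8 * C0 + b * a"
  have a: "a \<ge> 0" by (simp add: a_def)
  have "(LINT z:S|lborel. \<bar>centred_ln R y z\<bar>) \<le> C / K + K * measure lborel S"
    if S: "S \<in> sets borel" "S \<subseteq> cball 0 R" and K: "K > 0" for S K y
  proof -
    have mS: "emeasure lborel S < \<infinity>"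
      using S by (intro emeasure_bounded_finite) (auto intro: bounded_subset)
    have le: "\<bar>centred_ln R y z\<bar> \<le> (8 * inverse (cmod (z - y)) + b) / K + K" if "z \<in> S" for z
    proof -
      define l where "l = \<bar>centred_ln R y z\<bar>"
      have "2 * l * K \<le> l\<^sup>2 + K\<^sup>2" by (rule sum_squares_bound)
      moreover have "l * K \<ge> 0" using K by (simp add: l_def)
      ultimately have "l * K \<le> l\<^sup>2 + K * K" by (simp add: power2_eq_square)
      moreover have "l\<^sup>2 \<le> 8 * inverse (cmod (z - y)) + b"
        unfolding l_def b_def power2_abs using S that by (intro centred_ln_square_le R) auto
      ultimately have "l * K \<le> (8 * inverse (cmod (z - y)) + b) + K * K" by linarith
      thus ?thesis using K by (simp add: l_def field_simps)
    qed
    have i1: "set_integrable lborel (cball 0 R) (\<lambda>z. (8 * inverse (cmod (z - y)) + b) / K)"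
      by (intro set_integral_add set_integrable_const_cball C0 set_integrable_mult_right set_integrable_divide)
    have i2: "set_integrable lborel S (\<lambda>z::complex. K)"
      by (rule set_integrable_subset[OF set_integrable_const_cball[of 0 R]]) (use S in auto)
    have i3: "set_integrable lborel S (\<lambda>z. (8 * inverse (cmod (z - y)) + b) / K)"
      by (rule set_integrable_subset[OF i1]) (use S in auto)
    have i4: "set_integrable lborel S (\<lambda>z. \<bar>centred_ln R y z\<bar>)"
      by (intro set_integrable_abs set_integrable_subset[OF set_integrable_centred_ln]) (use S in auto)
    have "(LINT z:S|lborel. \<bar>centred_ln R y z\<bar>) \<le> (LINT z:S|lborel. (8 * inverse (cmod (z - y)) + b) / K + K)"
      by (rule set_integral_mono[OF i4 set_integral_add(1)[OF i3 i2]]) (rule le)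
    also have "\<dots> = (LINT z:S|lborel. (8 * inverse (cmod (z - y)) + b) / K) + K * measure lborel S"
      using S mS by (subst set_integral_add(2)[OF i3 i2]) (simp add: set_lebesgue_integral_def)
    also have "(LINT z:S|lborel. (8 * inverse (cmod (z - y)) + b) / K)
        \<le> (LINT z:cball 0 R|lborel. (8 * inverse (cmod (z - y)) + b) / K)"
      by (rule set_integral_subset_mono[OF i1]) (use S K b in auto)
    also have "\<dots> = (8 * (LINT z:cball 0 R|lborel. inverse (cmod (z - y))) + b * a) / K"
      using emeasure_compact_finite[of "cball (0::complex) R"] C0(2)
      by (simp add: set_integral_add set_integrable_const_cball set_lebesgue_integral_def[of _ _ "\<lambda>_. b"] a_def mult_ac)
    also have "\<dots> \<le> C / K"
      using C0(3)[of y] K by (simp add: C_def divide_right_mono)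
    finally show ?thesis by simp
  qed
  moreover have "C > 0" unfolding C_def using C0 a b by (intro add_pos_nonneg) auto
  ultimately show ?thesis using that by blast
qed


text \<open>The estimate is deterministic: \<delta> and N depend only on R and \<eta>. In ln |L| = c
  + E, the integral of E over a set V has modulus at most 2 n (C / M + M |V|) for any M > 0, while c
  is unknown. The lower bound -n Q for c comes from the set where ln |L| >= 0, which fills at least
  half of the disc. The positive part bypasses c and is controlled through |L| directly.\<close>

lemma log_deriv_L1_small:
  assumes R: "R > 0" and \<eta>: "\<eta> > 0"
  shows "\<exists>\<delta>>0. \<exists>N. \<forall>p. lead_coeff p = 1 \<longrightarrow> degree p \<ge> N \<longrightarrow>
    measure lborel {z \<in> cball 0 R. cmod (log_deriv p z) < 1} < \<delta> \<longrightarrow>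
    (LINT z:cball 0 R|lborel. \<bar>ln (cmod (log_deriv p z))\<bar>) \<le> \<eta> * real (degree p)"
proof -
  obtain C0 where C0: "C0 > 0"
    "\<And>x. set_integrable lborel (cball 0 R) (\<lambda>z. inverse (cmod (z - x)))"
    "\<And>x. (LINT z:cball 0 R|lborel. inverse (cmod (z - x))) \<le> C0"
    using inverse_dist_integral_bound by metis
  obtain C where C: "C > 0"
    "\<And>S K y. S \<in> sets borel \<Longrightarrow> S \<subseteq> cball 0 R \<Longrightarrow> K > 0 \<Longrightarrow>
       (LINT z:S|lborel. \<bar>centred_ln R y z\<bar>) \<le> C / K + K * measure lborel S"
    using centred_ln_integral_bound[OF R] by metis
  define D where "D = cball (0::complex) R"
  define a where "a = measure lborel D"
  have a: "a > 0" using R by (simp add: a_def D_def content_cball)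
  \<comment> \<open>From c * |U| + 2 n (C + a) >= 0 and |U| >= a / 2 one gets -c <= n * Q.\<close>
  define Q where "Q = 4 * (C + a) / a"
  have Q: "Q > 0" using C a by (simp add: Q_def)
  \<comment> \<open>The target is split in thirds: \<open>K\<close> makes (C0 + 2 C) / K at most
    \<eta> / 3; \<open>\<delta>\<close> makes (Q + 2 K) * \<delta> at most \<eta> / 3 and also
    guarantees |U| >= a / 2; \<open>N\<close> makes a * ln K at most n * \<eta> / 3.\<close>
  define K where "K = max 1 (3 * (C0 + 2 * C) / \<eta>)"
  have K: "K \<ge> 1" "K > 0" "(C0 + 2 * C) / K \<le> \<eta> / 3"
    using C0 C \<eta> by (auto simp: K_def field_simps max_def)
  define \<delta> where "\<delta> = min (a / 2) (\<eta> / (3 * (Q + 2 * K)))"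
  have \<delta>: "\<delta> > 0" using a \<eta> Q K by (simp add: \<delta>_def)
  define N where "N = max 1 (nat \<lceil>3 * a * ln K / \<eta>\<rceil>)"
  have [measurable]: "D \<in> sets borel" by (simp add: D_def)
  have Dfin: "emeasure lborel D < \<infinity>" unfolding D_def by (rule emeasure_compact_finite) simp
  have cst: "set_integrable lborel V (\<lambda>_. b)" "(LINT z:V|lborel. b) = b * measure lborel V"
    if "V \<in> sets borel" "V \<subseteq> D" for V and b :: real
  proof -
    show "set_integrable lborel V (\<lambda>_. b)"
      by (rule set_integrable_subset[OF set_integrable_const_cball[of 0 R]]) (use that in \<open>auto simp: D_def\<close>)
    have "emeasure lborel V < \<infinity>"
      using that by (intro emeasure_bounded_finite) (auto simp: D_def intro: bounded_subset)
    thus "(LINT z:V|lborel. b) = b * measure lborel V"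
      using that by (simp add: set_lebesgue_integral_def)
  qed
  have main: "(LINT z:D|lborel. \<bar>ln (cmod (log_deriv p z))\<bar>) \<le> \<eta> * real (degree p)"
    if p: "lead_coeff p = 1" and N: "degree p \<ge> N"
      and small: "measure lborel {z \<in> D. cmod (log_deriv p z) < 1} < \<delta>" for p
  proof -
    define n where "n = real (degree p)"
    have deg: "degree p \<ge> 1" using N by (auto simp: N_def)
    have n: "n > 0" "3 * a * ln K / \<eta> \<le> n" using N deg by (auto simp: n_def N_def)
    define L where "L = (\<lambda>z. ln (cmod (log_deriv p z)))"
    have [measurable]: "L \<in> borel_measurable borel" unfolding L_def by measurable
    define S where "S = {z \<in> D. cmod (log_deriv p z) < 1}"
    define U where "U = D - S"
    have "{z \<in> space borel. cmod (log_deriv p z) < 1} \<in> sets borel"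
      by (rule borel_measurable_less) measurable
    moreover have "S = D \<inter> {z \<in> space borel. cmod (log_deriv p z) < 1}" by (auto simp: S_def)
    ultimately have S: "S \<in> sets borel" "S \<subseteq> D" by auto
    have U: "U \<in> sets borel" "U \<subseteq> D" unfolding U_def using S by auto
    have SU: "D = S \<union> U" "S \<inter> U = {}" using S by (auto simp: U_def)
    have mSU: "measure lborel S + measure lborel U = a"
      unfolding a_def U_def using measure_Diff[of lborel D S] S Dfin by auto
    have mS: "measure lborel S < \<delta>" "measure lborel S \<ge> 0" using small by (auto simp: S_def)
    have mU: "measure lborel U \<ge> a / 2" "measure lborel U \<le> a"
      using mSU mS by (auto simp: \<delta>_def)
    have LD: "set_integrable lborel D L"
      unfolding L_def D_def by (rule set_integrable_ln_log_deriv[OF p deg])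
    have LV: "set_integrable lborel V L" if "V \<in> sets borel" "V \<subseteq> D" for V
      by (rule set_integrable_subset[OF LD]) (use that in auto)

    define A where "A = proots p"
    define B where "B = proots (pderiv p)"
    have sizeA: "real (size A) = n" by (simp add: A_def n_def size_proots_complex)
    have sizeB: "real (size B) \<le> n"
      by (simp add: B_def n_def size_proots_complex degree_pderiv)
    define E where "E = (\<lambda>z. (\<Sum>y\<in>#B. centred_ln R y z) - (\<Sum>x\<in>#A. centred_ln R x z))"
    define \<kappa> where "\<kappa> = (\<lambda>y. if cmod y \<le> 2 * R then 0 else ln (cmod y))"
    \<comment> \<open>Undoing the centring puts ln |y| for all far zeros into \<open>c\<close>: it
      has no a priori size, but it does not depend on z.\<close>
    define c where "c = ln n + (\<Sum>y\<in>#B. \<kappa> y) - (\<Sum>x\<in>#A. \<kappa> x)"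
    have sum_ln: "(\<Sum>y\<in>#Y. ln (cmod (z - y))) = (\<Sum>y\<in>#Y. centred_ln R y z) + (\<Sum>y\<in>#Y. \<kappa> y)" for Y z
      unfolding sum_mset.distrib[symmetric] by (simp add: centred_ln_def \<kappa>_def)
    have LE: "AE z in lborel. L z = c + E z"
      using AE_ln_cmod_log_deriv[OF p deg]
      by eventually_elim (simp add: L_def c_def E_def sum_ln n_def A_def B_def)
    have [measurable]: "E \<in> borel_measurable borel"
      unfolding E_def by (intro borel_measurable_diff borel_measurable_sum_mset) measurable
    have cl: "set_integrable lborel V (centred_ln R y)" if "V \<in> sets borel" "V \<subseteq> D" for V y
      by (rule set_integrable_subset[OF set_integrable_centred_ln[of R]]) (use that in \<open>auto simp: D_def\<close>)
    have EV: "set_integrable lborel V E" if "V \<in> sets borel" "V \<subseteq> D" for V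
      unfolding E_def using that by (intro set_integral_diff set_integrable_sum_mset cl)
    have intL: "(LINT z:V|lborel. L z) = c * measure lborel V + (LINT z:V|lborel. E z)"
      if V: "V \<in> sets borel" "V \<subseteq> D" for V
    proof -
      have "(LINT z:V|lborel. L z) = (LINT z:V|lborel. c + E z)"
        by (rule set_lebesgue_integral_cong_AE) (use V LE in auto)
      also have "\<dots> = c * measure lborel V + (LINT z:V|lborel. E z)"
        using cst[OF V] EV[OF V] by simp
      finally show ?thesis .
    qed
    have intE: "\<bar>LINT z:V|lborel. E z\<bar> \<le> 2 * n * (C / M + M * measure lborel V)"
      if V: "V \<in> sets borel" "V \<subseteq> D" and M: "M > 0" for V M
    proof -
      define h where "h = C / M + M * measure lborel V"
      have h: "h \<ge> 0" using C M by (simp add: h_def)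
      have 1: "\<bar>LINT z:V|lborel. centred_ln R y z\<bar> \<le> h" for y
      proof -
        have "\<bar>LINT z:V|lborel. centred_ln R y z\<bar> \<le> (LINT z:V|lborel. \<bar>centred_ln R y z\<bar>)"
          using cl[OF V] set_integral_norm_bound[of lborel V "centred_ln R y"] by simp
        also have "\<dots> \<le> h"
          unfolding h_def using V M by (intro C(2)) (auto simp: D_def)
        finally show ?thesis .
      qed
      have 2: "\<bar>\<Sum>y\<in>#Y. LINT z:V|lborel. centred_ln R y z\<bar> \<le> real (size Y) * h" for Y
      proof (induction Y)
        case (add y Y)
        thus ?case using 1[of y] by (simp add: ring_distribs)
      qed auto
      have "(LINT z:V|lborel. E z) = (\<Sum>y\<in>#B. LINT z:V|lborel. centred_ln R y z)
            - (\<Sum>y\<in>#A. LINT z:V|lborel. centred_ln R y z)"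
        unfolding E_def using cl[OF V]
        by (simp add: set_integral_sum_mset set_integrable_sum_mset)
      hence "\<bar>LINT z:V|lborel. E z\<bar> \<le> real (size B) * h + real (size A) * h"
        using 2[of A] 2[of B] by linarith
      also have "\<dots> \<le> n * h + n * h"
        using sizeA sizeB h by (intro add_mono mult_right_mono) auto
      finally show ?thesis by (simp add: h_def)
    qed

    \<comment> \<open>Integrating over the set where L is nonnegative bounds the unknown constant c from below.\<close>
    have "0 \<le> (LINT z:U|lborel. L z)"
    proof -
      have "(LINT z:U|lborel. 0) \<le> (LINT z:U|lborel. L z)"
        by (rule set_integral_mono[OF cst(1)[OF U] LV[OF U]]) (auto simp: L_def U_def S_def)
      thus ?thesis by simp
    qed
    \<comment> \<open>The choice M = 1 in \<open>intE\<close> is enough here, as |U| is at most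
      a.\<close>
    also have "\<dots> \<le> c * measure lborel U + 2 * n * (C + a)"
    proof -
      have "2 * n * (C + measure lborel U) \<le> 2 * n * (C + a)"
        using n mU by (intro mult_left_mono) auto
      thus ?thesis using intL[OF U] intE[OF U, of 1] by simp
    qed
    finally have c0: "0 \<le> c * measure lborel U + 2 * n * (C + a)" .
    have c: "- c \<le> n * Q"
    proof (rule ccontr)
      assume "\<not> - c \<le> n * Q"
      hence "n * Q < - c" by simp
      hence "n * Q * (a / 2) < - c * (a / 2)" using a by (intro mult_strict_right_mono) auto
      also have "\<dots> \<le> - c * measure lborel U"
        using mU \<open>n * Q < - c\<close> mult_pos_pos[OF n(1) Q] by (intro mult_left_mono) auto
      also have "\<dots> \<le> 2 * n * (C + a)" using c0 by simp
      finally show False using a by (simp add: Q_def field_simps)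
    qed

    have "(LINT z:S|lborel. \<bar>L z\<bar>) = - (LINT z:S|lborel. L z)"
    proof -
      \<comment> \<open>At zeros of \<open>log_deriv p\<close> the default \<open>ln 0 = 0\<close>
        applies, so the sign is right there as well.\<close>
      have "ln (cmod w) \<le> 0" if "cmod w < 1" for w
        using that by (cases "w = 0") auto
      hence "(LINT z:S|lborel. \<bar>L z\<bar>) = (LINT z:S|lborel. - L z)"
        using S by (intro set_lebesgue_integral_cong) (auto simp: L_def S_def)
      also have "\<dots> = - (LINT z:S|lborel. L z)" by (rule set_integral_uminus[OF LV[OF S]])
      finally show ?thesis .
    qed
    also have "\<dots> = - c * measure lborel S - (LINT z:S|lborel. E z)" using intL[OF S] by simp
    also have "\<dots> \<le> n * Q * measure lborel S + 2 * n * (C / K + K * measure lborel S)"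
      using intE[OF S K(2)] mult_right_mono[OF c mS(2)] by linarith
    also have "\<dots> = n * (2 * C / K) + n * (Q + 2 * K) * measure lborel S" by (simp add: algebra_simps)
    also have "n * (Q + 2 * K) * measure lborel S \<le> n * (Q + 2 * K) * (\<eta> / (3 * (Q + 2 * K)))"
      using mS n Q K by (intro mult_left_mono) (auto simp: \<delta>_def)
    also have "\<dots> = n * (\<eta> / 3)"
      using Q K by (simp add: field_simps)
    finally have intS: "(LINT z:S|lborel. \<bar>L z\<bar>) \<le> n * (2 * C / K) + n * (\<eta> / 3)" by simp

    have inv: "set_integrable lborel D (\<lambda>z. (\<Sum>x\<in>#A. inverse (cmod (z - x))))"
      unfolding D_def by (intro set_integrable_sum_mset C0)
    have "(LINT z:U|lborel. \<bar>L z\<bar>) \<le> (LINT z:U|lborel. (\<Sum>x\<in>#A. inverse (cmod (z - x))) / K + ln K)"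
    proof (rule set_integral_mono)
      show "set_integrable lborel U (\<lambda>z. (\<Sum>x\<in>#A. inverse (cmod (z - x))) / K + ln K)"
        by (intro set_integral_add set_integrable_divide cst[OF U] set_integrable_subset[OF inv]) (use U in auto)
      fix z assume z: "z \<in> U"
      define l where "l = cmod (log_deriv p z)"
      have l: "l \<ge> 1" using z by (auto simp: U_def S_def l_def)
      \<comment> \<open>Tangent bound for ln at K: the slope 1 / K damps the integral of |L|, which
        is of order n, at the cost of the constant ln K.\<close>
      have "ln (l / K) \<le> l / K - 1" using l K by (intro ln_le_minus_one) auto
      hence "ln l \<le> l / K + ln K" using l K by (simp add: ln_div)
      moreover have "l \<le> (\<Sum>x\<in>#A. inverse (cmod (z - x)))"
      proof -
        have "cmod (\<Sum>x\<in>#Y. inverse (z - x)) \<le> (\<Sum>x\<in>#Y. inverse (cmod (z - x)))" for Y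
          by (induction Y) (auto simp: norm_inverse intro!: order_trans[OF norm_triangle_ineq])
        thus ?thesis by (simp add: l_def log_deriv_def A_def)
      qed
      hence "l / K \<le> (\<Sum>x\<in>#A. inverse (cmod (z - x))) / K" using K by (intro divide_right_mono) auto
      ultimately show "\<bar>L z\<bar> \<le> (\<Sum>x\<in>#A. inverse (cmod (z - x))) / K + ln K"
        using l by (simp add: L_def flip: l_def)
    qed (intro set_integrable_abs LV U)
    also have "\<dots> \<le> (LINT z:D|lborel. (\<Sum>x\<in>#A. inverse (cmod (z - x))) / K + ln K)"
    proof (rule set_integral_subset_mono)
      show "set_integrable lborel D (\<lambda>z. (\<Sum>x\<in>#A. inverse (cmod (z - x))) / K + ln K)"
        by (intro set_integral_add set_integrable_divide cst inv) auto
      have "0 \<le> (\<Sum>x\<in>#Y. inverse (cmod (z - x)))" for Y z by (induction Y) auto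
      thus "0 \<le> (\<Sum>x\<in>#A. inverse (cmod (z - x))) / K + ln K" for z
        using K by (intro add_nonneg_nonneg divide_nonneg_nonneg) auto
    qed (use U in auto)
    also have "\<dots> = (\<Sum>x\<in>#A. LINT z:D|lborel. inverse (cmod (z - x))) / K + ln K * a"
      using inv C0(2) cst[of D] by (simp add: set_integral_sum_mset D_def[symmetric] a_def)
    also have "(\<Sum>x\<in>#A. LINT z:D|lborel. inverse (cmod (z - x))) \<le> n * C0"
    proof -
      have "(\<Sum>x\<in>#Y. LINT z:D|lborel. inverse (cmod (z - x))) \<le> real (size Y) * C0" for Y
        by (induction Y) (use C0(3) in \<open>auto simp: D_def ring_distribs intro!: add_mono\<close>)
      thus ?thesis using sizeA by metis
    qed
    also have "ln K * a \<le> n * (\<eta> / 3)" using n \<eta> by (simp add: field_simps)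
    finally have intU: "(LINT z:U|lborel. \<bar>L z\<bar>) \<le> n * C0 / K + n * (\<eta> / 3)"
      using K by (simp add: divide_right_mono)

    have "(LINT z:D|lborel. \<bar>L z\<bar>) = (LINT z:S|lborel. \<bar>L z\<bar>) + (LINT z:U|lborel. \<bar>L z\<bar>)"
      unfolding SU(1) by (intro set_integral_Un set_integrable_abs LV S U SU)
    also have "\<dots> \<le> n * ((C0 + 2 * C) / K) + n * (2 * \<eta> / 3)"
      using intS intU by (simp add: algebra_simps add_divide_distrib)
    also have "\<dots> \<le> n * (\<eta> / 3) + n * (2 * \<eta> / 3)"
      using K n by (intro add_mono mult_left_mono) auto
    finally show ?thesis by (simp add: L_def n_def algebra_simps)
  qed
  show ?thesis
    by (intro exI[of _ \<delta>] conjI exI[of _ N] allI impI \<delta>) (use main in \<open>auto simp: D_def\<close>)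
qed

section \<open>Anti-concentration\<close>

text \<open>The indicator of [-1, 1] is at most a multiple of the Gaussian, which is its own Fourier transform.\<close>

lemma (in prob_space) prob_abs_add_le_1_le_char:
  fixes S :: "'a \<Rightarrow> real"
  assumes [measurable]: "S \<in> borel_measurable M"
  shows "prob {\<omega> \<in> space M. \<bar>S \<omega> + c\<bar> \<le> 1}
    \<le> exp (1/2) * (\<integral>t. cmod (char (distr M borel S) t) \<partial>std_normal_distribution)"
proof -
  interpret N: real_distribution std_normal_distribution by (rule real_dist_normal_dist)
  interpret P: pair_prob_space M std_normal_distribution ..
  interpret S: real_distribution "distr M borel S" by simp
  let ?h = "\<lambda>\<omega> t. iexp ((S \<omega> + c) * t)"
  have int: "integrable (M \<Otimes>\<^sub>M std_normal_distribution) (\<lambda>(\<omega>, t). ?h \<omega> t)"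
    by (rule P.integrable_const_bound[of _ 1]) (auto simp: norm_exp_i_times simp del: of_real_mult of_real_add)
  \<comment> \<open>The Gaussian exp (-s^2 / 2) is the characteristic function of the standard
    normal law at s, so Fubini turns its mean into an integral of the characteristic function of
    S.\<close>
  have "complex_of_real (\<integral>\<omega>. exp (- (S \<omega> + c)\<^sup>2 / 2) \<partial>M)
      = (\<integral>\<omega>. char std_normal_distribution (S \<omega> + c) \<partial>M)"
    by (simp add: char_std_normal_distribution)
  also have "\<dots> = (\<integral>\<omega>. (\<integral>t. ?h \<omega> t \<partial>std_normal_distribution) \<partial>M)"
    by (simp add: char_def)
  also have "\<dots> = (\<integral>t. (\<integral>\<omega>. ?h \<omega> t \<partial>M) \<partial>std_normal_distribution)"
    using P.Fubini_integral[OF int] by simp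
  also have "\<dots> = (\<integral>t. iexp (c * t) * char (distr M borel S) t \<partial>std_normal_distribution)"
  proof (rule Bochner_Integration.integral_cong)
    fix t
    have "(\<integral>\<omega>. ?h \<omega> t \<partial>M) = (\<integral>\<omega>. iexp (c * t) * iexp (t * S \<omega>) \<partial>M)"
      by (intro Bochner_Integration.integral_cong) (auto simp: algebra_simps simp flip: exp_add)
    also have "\<dots> = iexp (c * t) * char (distr M borel S) t"
      by (simp add: char_def integral_distr)
    finally show "(\<integral>\<omega>. ?h \<omega> t \<partial>M) = iexp (c * t) * char (distr M borel S) t" .
  qed auto
  finally have eq: "complex_of_real (\<integral>\<omega>. exp (- (S \<omega> + c)\<^sup>2 / 2) \<partial>M)
     = (\<integral>t. iexp (c * t) * char (distr M borel S) t \<partial>std_normal_distribution)" .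
  have "(\<integral>\<omega>. exp (- (S \<omega> + c)\<^sup>2 / 2) \<partial>M) \<le> cmod (complex_of_real (\<integral>\<omega>. exp (- (S \<omega> + c)\<^sup>2 / 2) \<partial>M))"
    by simp
  also have "\<dots> \<le> (\<integral>t. cmod (iexp (c * t) * char (distr M borel S) t) \<partial>std_normal_distribution)"
    unfolding eq by (rule integral_norm_bound)
  \<comment> \<open>The shift c survives only as a factor of modulus 1, which makes the bound
    uniform in c.\<close>
  also have "\<dots> = (\<integral>t. cmod (char (distr M borel S) t) \<partial>std_normal_distribution)"
    by (simp add: norm_mult norm_exp_i_times del: of_real_mult)
  finally have E: "(\<integral>\<omega>. exp (- (S \<omega> + c)\<^sup>2 / 2) \<partial>M) \<le> \<dots>" .
  have "prob {\<omega> \<in> space M. \<bar>S \<omega> + c\<bar> \<le> 1}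
      = (\<integral>\<omega>. indicator {\<omega> \<in> space M. \<bar>S \<omega> + c\<bar> \<le> 1} \<omega> \<partial>M)" by simp
  \<comment> \<open>On |S + c| <= 1 the Gaussian is at least exp (-1/2), whence the factor exp
    (1/2).\<close>
  also have "\<dots> \<le> (\<integral>\<omega>. exp (1/2) * exp (- (S \<omega> + c)\<^sup>2 / 2) \<partial>M)"
  proof (rule integral_mono)
    show "integrable M (\<lambda>\<omega>. exp (1/2) * exp (- (S \<omega> + c)\<^sup>2 / 2))"
      by (rule integrable_const_bound[of _ "exp (1/2)"]) (auto simp: mult_le_cancel_left1)
    show "integrable M (indicat_real {\<omega> \<in> space M. \<bar>S \<omega> + c\<bar> \<le> 1})"
      by (rule integrable_const_bound[of _ 1]) (auto simp: indicator_def)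
    show "indicat_real {\<omega> \<in> space M. \<bar>S \<omega> + c\<bar> \<le> 1} \<omega> \<le> exp (1/2) * exp (- (S \<omega> + c)\<^sup>2 / 2)" for \<omega>
    proof (cases "\<bar>S \<omega> + c\<bar> \<le> 1")
      case True
      hence "(S \<omega> + c)\<^sup>2 \<le> 1" by (simp add: abs_square_le_1)
      hence "0 \<le> 1/2 + - (S \<omega> + c)\<^sup>2 / 2" by simp
      thus ?thesis unfolding exp_add[symmetric] by (auto simp: indicator_def)
    qed (auto simp: indicator_def)
  qed
  also have "\<dots> = exp (1/2) * (\<integral>\<omega>. exp (- (S \<omega> + c)\<^sup>2 / 2) \<partial>M)" by simp
  also have "\<dots> \<le> exp (1/2) * (\<integral>t. cmod (char (distr M borel S) t) \<partial>std_normal_distribution)"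
    using E by (intro mult_left_mono) auto
  finally show ?thesis .
qed

text \<open>Rotating by the argument \<theta> of the characteristic function turns modulus 1 into an
  integral of cos (t y - \<theta>) equal to 1. Since cos <= 1, this forces cos = 1 almost
  everywhere.\<close>

lemma (in real_distribution) cmod_char_eq_1_imp_lattice:
  assumes "cmod (char M t) = 1"
  shows "\<exists>\<theta>. AE y in M. \<exists>k::int. t * y - \<theta> = 2 * pi * of_int k"
proof -
  define \<theta> where "\<theta> = Arg (char M t)"
  have ch: "char M t = cis \<theta>" using assms cis_Arg[of "char M t"] by (cases "char M t = 0") (auto simp: \<theta>_def sgn_div_norm)
  have int: "integrable M (\<lambda>y. iexp (t * y))" by (rule integrable_const_bound[of _ 1]) (auto simp del: of_real_mult)
  have "(\<integral>y. cis (-\<theta>) * iexp (t * y) \<partial>M) = cis (-\<theta>) * char M t"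
    by (simp add: char_def)
  also have "\<dots> = 1" by (simp add: ch cis_mult)
  finally have "Re (\<integral>y. cis (-\<theta>) * iexp (t * y) \<partial>M) = 1" by simp
  moreover have "Re (\<integral>y. cis (-\<theta>) * iexp (t * y) \<partial>M) = (\<integral>y. Re (cis (-\<theta>) * iexp (t * y)) \<partial>M)"
    using int by (intro integral_Re[symmetric]) auto
  moreover have "Re (cis (-\<theta>) * iexp (t * y)) = cos (t * y - \<theta>)" for y
    by (simp add: cis_mult algebra_simps flip: cis_conv_exp of_real_mult)
  ultimately have "(\<integral>y. cos (t * y - \<theta>) \<partial>M) = 1" by simp
  moreover have icos: "integrable M (\<lambda>y. cos (t * y - \<theta>))"
    by (rule integrable_const_bound[of _ 1]) auto
  ultimately have "(\<integral>y. 1 - cos (t * y - \<theta>) \<partial>M) = 0" 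
    using prob_space by (simp del: space_eq_univ)
  hence "AE y in M. 1 - cos (t * y - \<theta>) = 0"
    using icos by (subst (asm) integral_nonneg_eq_0_iff_AE) auto
  hence "AE y in M. \<exists>k::int. t * y - \<theta> = 2 * pi * of_int k"
    by eventually_elim (auto simp: cos_one_2pi_int mult_ac)
  thus ?thesis by blast
qed

lemma AE_at_atom:
  assumes "AE y in M. P y" "{u} \<in> sets M" "emeasure M {u} \<noteq> 0"
  shows "P u"
proof (rule ccontr)
  assume "\<not> P u"
  from assms(1) have "AE y in M. y \<notin> {u}" by eventually_elim (use \<open>\<not> P u\<close> in auto)
  hence "emeasure M {u} = 0" using assms(2) by (simp add: AE_iff_null_sets null_setsD1)
  thus False using assms(3) by simp
qed

text \<open>One nonzero t of modulus 1 confines the law to a countable lattice, so a nondegenerate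
  law then has two distinct atoms u and v. For every t in question, t * u and t * v are congruent
  modulo 2 * pi, which leaves only the countably many t with t * (u - v) an integer multiple of 2 *
  pi.\<close>

lemma (in real_distribution) countable_cmod_char_eq_1:
  assumes nondeg: "\<And>u. \<not> (AE y in M. y = u)"
  shows "countable {t. cmod (char M t) = 1}"
proof (cases "\<exists>t0. t0 \<noteq> 0 \<and> cmod (char M t0) = 1")
  case False
  hence "{t. cmod (char M t) = 1} \<subseteq> {0}" by auto
  thus ?thesis by (rule countable_subset) auto
next
  case True
  then obtain t0 where t0: "t0 \<noteq> 0" "cmod (char M t0) = 1" by auto
  from cmod_char_eq_1_imp_lattice[OF t0(2)] obtain \<theta> where
    "AE y in M. \<exists>k::int. t0 * y - \<theta> = 2 * pi * of_int k" by blast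
  define Z where "Z = range (\<lambda>k::int. (\<theta> + 2 * pi * of_int k) / t0)"
  have Z: "countable Z" by (simp add: Z_def)
  have AEZ: "AE y in M. y \<in> Z"
    using \<open>AE y in M. _\<close>
  proof eventually_elim
    case (elim y)
    then obtain k :: int where "t0 * y - \<theta> = 2 * pi * of_int k" by blast
    hence "y = (\<theta> + 2 * pi * of_int k) / t0" using t0 by (simp add: field_simps)
    thus ?case by (auto simp: Z_def)
  qed
  \<comment> \<open>If u were the only possible atom, the countable set Z - {u} would be null and
    the law concentrated at u.\<close>
  have atom: "\<exists>v. v \<noteq> u \<and> emeasure M {v} \<noteq> 0" for u
  proof (rule ccontr)
    assume "\<not> ?thesis"
    hence "{v} \<in> null_sets M" if "v \<noteq> u" for v using that by (auto simp: null_sets_def)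
    hence "(\<Union>v\<in>Z - {u}. {v}) \<in> null_sets M"
      using Z by (intro null_sets_UN') auto
    from AE_not_in[OF this] AEZ have "AE y in M. y = u" by eventually_elim auto
    thus False using nondeg by blast
  qed
  obtain u where u: "emeasure M {u} \<noteq> 0" using atom by blast
  obtain v where v: "v \<noteq> u" "emeasure M {v} \<noteq> 0" using atom by blast
  have "{t. cmod (char M t) = 1} \<subseteq> range (\<lambda>k::int. 2 * pi * of_int k / (u - v))"
  proof safe
    fix t assume "cmod (char M t) = 1"
    from cmod_char_eq_1_imp_lattice[OF this] obtain \<theta> where
      AE: "AE y in M. \<exists>k::int. t * y - \<theta> = 2 * pi * of_int k" by blast
    obtain k :: int where k: "t * u - \<theta> = 2 * pi * of_int k" using AE_at_atom[OF AE _ u] by auto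
    obtain l :: int where l: "t * v - \<theta> = 2 * pi * of_int l" using AE_at_atom[OF AE _ v(2)] by auto
    have "t * (u - v) = 2 * pi * of_int (k - l)" using k l by (simp add: algebra_simps)
    hence "t = 2 * pi * of_int (k - l) / (u - v)" using v by (simp add: field_simps)
    thus "t \<in> range (\<lambda>k::int. 2 * pi * of_int k / (u - v))" by blast
  qed
  thus ?thesis by (rule countable_subset) auto
qed

text \<open>Off a countable, hence null, set of t the modulus is strictly below 1, so dominated
  convergence applies to its powers.\<close>

lemma (in real_distribution) integral_char_power_tendsto_0:
  assumes nondeg: "\<And>u. \<not> (AE y in M. y = u)"
  shows "(\<lambda>m. \<integral>t. cmod (char M t) ^ m \<partial>std_normal_distribution) \<longlonglongrightarrow> 0"
proof -
  interpret N: real_distribution std_normal_distribution by (rule real_dist_normal_dist)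
  have "{t. cmod (char M t) = 1} \<in> null_sets lborel"
    using countable_cmod_char_eq_1[OF nondeg] by (rule countable_imp_null_set_lborel)
  from AE_not_in[OF this] have "AE t in lborel. cmod (char M t) \<noteq> 1" by simp
  hence AE: "AE t in std_normal_distribution. cmod (char M t) \<noteq> 1"
    by (subst AE_density) auto
  have "(\<lambda>m. \<integral>t. cmod (char M t) ^ m \<partial>std_normal_distribution)
      \<longlonglongrightarrow> (\<integral>t. 0 \<partial>std_normal_distribution)"
  proof (rule integral_dominated_convergence[where w = "\<lambda>_. 1"])
    show "AE t in std_normal_distribution. (\<lambda>m. cmod (char M t) ^ m) \<longlonglongrightarrow> 0"
      using AE
    proof eventually_elim
      case (elim t)
      hence "cmod (char M t) < 1" using cmod_char_le_1[of t] by simp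
      thus ?case by (intro LIMSEQ_realpow_zero) auto
    qed
    show "AE t in std_normal_distribution. norm (cmod (char M t) ^ m) \<le> 1" for m
      using cmod_char_le_1 by (auto intro!: power_le_one)
  qed auto
  thus ?thesis by simp
qed

text \<open>The characteristic function of the sum is a power of that of a single term, and the
  concentration bound does not see the shifts \<open>c n\<close>, which may therefore be
  arbitrary.\<close>

lemma (in prob_space) iid_sum_concentration_tendsto_0:
  fixes Y :: "nat \<Rightarrow> 'a \<Rightarrow> real"
  assumes indep: "indep_vars (\<lambda>_. borel) Y UNIV"
    and distr: "\<And>j. distr M borel (Y j) = \<nu>"
    and nondeg: "\<And>u. \<not> (AE y in \<nu>. y = u)"
    and m: "filterlim m at_top sequentially"
  shows "(\<lambda>n. prob {\<omega> \<in> space M. \<bar>(\<Sum>j<m n. Y j \<omega>) + c n\<bar> \<le> 1}) \<longlonglongrightarrow> 0"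
proof -
  have [measurable]: "Y j \<in> borel_measurable M" for j using indep by (auto simp: indep_vars_def)
  have "real_distribution (distr M borel (Y 0))" by simp
  then interpret \<nu>: real_distribution \<nu> by (simp add: distr)
  let ?I = "\<lambda>k. \<integral>t. cmod (char \<nu> t) ^ k \<partial>std_normal_distribution"
  have "(\<lambda>n. exp (1/2) * ?I (m n)) \<longlonglongrightarrow> exp (1/2) * 0"
    by (intro tendsto_intros filterlim_compose[OF \<nu>.integral_char_power_tendsto_0[OF nondeg] m])
  hence lim: "(\<lambda>n. exp (1/2) * ?I (m n)) \<longlonglongrightarrow> 0" by simp
  have "prob {\<omega> \<in> space M. \<bar>(\<Sum>j<m n. Y j \<omega>) + c n\<bar> \<le> 1} \<le> exp (1/2) * ?I (m n)" for n
  proof -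
    have "char (distr M borel (\<lambda>\<omega>. \<Sum>j<m n. Y j \<omega>)) t = char \<nu> t ^ m n" for t
      using char_distr_sum[OF indep_vars_subset[OF indep], of "{..<m n}" t] by (simp add: distr)
    thus ?thesis
      using prob_abs_add_le_1_le_char[of "\<lambda>\<omega>. \<Sum>j<m n. Y j \<omega>" "c n"] by (simp add: norm_power)
  qed
  thus ?thesis by (intro tendsto_sandwich[OF _ _ tendsto_const lim]) auto
qed

text \<open>Complex terms are reduced to real ones by projecting with Re or Im, which cannot
  increase the modulus. At least one projection is nondegenerate: if both were almost surely
  constant, so would be 1 / (z - x) and hence x.\<close>

lemma (in prob_space) resolvent_sum_concentration_tendsto_0:
  fixes X :: "nat \<Rightarrow> 'a \<Rightarrow> complex"
  assumes indep: "indep_vars (\<lambda>_. borel) X UNIV"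
    and distr: "\<And>j. distr M borel (X j) = \<mu>"
    and nondeg: "\<And>u. \<not> (AE x in \<mu>. x = u)"
    and m: "filterlim m at_top sequentially"
  shows "(\<lambda>n. prob {\<omega> \<in> space M. cmod ((\<Sum>j<m n. inverse (z - X j \<omega>)) + c n) < 1}) \<longlonglongrightarrow> 0"
proof -
  have X [measurable]: "X j \<in> borel_measurable M" for j using indep by (auto simp: indep_vars_def)
  have sets_\<mu> [measurable_cong]: "sets \<mu> = sets borel" using distr[of 0] by (metis sets_distr)
  have *: ?thesis
    if g_add: "\<And>v w. g (v + w) = g v + g w" and g_0: "g 0 = 0" and g_le: "\<And>w. \<bar>g w\<bar> \<le> cmod w"
      and [measurable]: "g \<in> borel_measurable borel"
      and nd: "\<And>u. \<not> (AE x in \<mu>. g (inverse (z - x)) = u)" for g :: "complex \<Rightarrow> real"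
  proof -
    define Y where "Y = (\<lambda>j \<omega>. g (inverse (z - X j \<omega>)))"
    have Y [measurable]: "Y j \<in> borel_measurable M" for j unfolding Y_def by measurable
    have "indep_vars (\<lambda>_. borel) Y UNIV"
      unfolding Y_def by (rule indep_vars_compose2[OF indep]) measurable
    moreover have "distr M borel (Y j) = distr \<mu> borel (\<lambda>x. g (inverse (z - x)))" for j
      unfolding distr[of j, symmetric] Y_def by (subst distr_distr) (auto simp: o_def)
    moreover have "\<not> (AE y in distr \<mu> borel (\<lambda>x. g (inverse (z - x))). y = u)" for u
      using nd[of u] by (subst AE_distr_iff) auto
    ultimately have lim: "(\<lambda>n. prob {\<omega> \<in> space M. \<bar>(\<Sum>j<m n. Y j \<omega>) + g (c n)\<bar> \<le> 1}) \<longlonglongrightarrow> 0"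
      using m by (rule iid_sum_concentration_tendsto_0)
    have g_sum: "g (\<Sum>j<k. h j) = (\<Sum>j<k. g (h j))" for k :: nat and h
      by (induction k) (auto simp: g_0 g_add)
    have "prob {\<omega> \<in> space M. cmod ((\<Sum>j<m n. inverse (z - X j \<omega>)) + c n) < 1}
        \<le> prob {\<omega> \<in> space M. \<bar>(\<Sum>j<m n. Y j \<omega>) + g (c n)\<bar> \<le> 1}" for n
    proof (rule finite_measure_mono)
      show "{\<omega> \<in> space M. cmod ((\<Sum>j<m n. inverse (z - X j \<omega>)) + c n) < 1}
          \<subseteq> {\<omega> \<in> space M. \<bar>(\<Sum>j<m n. Y j \<omega>) + g (c n)\<bar> \<le> 1}"
      proof safe
        fix \<omega> assume "cmod ((\<Sum>j<m n. inverse (z - X j \<omega>)) + c n) < 1"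
        thus "\<bar>(\<Sum>j<m n. Y j \<omega>) + g (c n)\<bar> \<le> 1"
          using g_le[of "(\<Sum>j<m n. inverse (z - X j \<omega>)) + c n"] by (simp add: g_add g_sum Y_def)
      qed
    qed measurable
    thus ?thesis by (intro tendsto_sandwich[OF _ _ tendsto_const lim]) auto
  qed
  show ?thesis
  proof (cases "\<exists>u. AE x in \<mu>. Re (inverse (z - x)) = u")
    case False
    thus ?thesis by (intro *[of Re]) (auto simp: abs_Re_le_cmod)
  next
    case True
    then obtain u where u: "AE x in \<mu>. Re (inverse (z - x)) = u" by blast
    show ?thesis
    proof (rule *[of Im])
      fix v
      show "\<not> (AE x in \<mu>. Im (inverse (z - x)) = v)"
      proof
        assume "AE x in \<mu>. Im (inverse (z - x)) = v"
        with u have "AE x in \<mu>. x = z - inverse (Complex u v)"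
        proof eventually_elim
          case (elim x)
          hence "inverse (z - x) = Complex u v" by (simp add: complex_eq_iff)
          \<comment> \<open>\<open>inverse\<close> is an involution also at 0, so a possible atom at
            x = z is covered.\<close>
          hence "z - x = inverse (Complex u v)" by (metis inverse_inverse_eq)
          thus ?case by (simp add: algebra_simps)
        qed
        thus False using nondeg by blast
      qed
    qed (auto simp: abs_Im_le_cmod)
  qed
qed

text \<open>The product measure of the pairs (\<omega>, z) where the sum is small is the expected
  area. Computed by slices in z it tends to 0: each slice probability does, and the indicator of the
  disc dominates. Markov's inequality then bounds the probability that the area is at least
  \<delta>. The shift \<open>c n z\<close> may vary with z, since concentration is used for one z at
  a time.\<close>

lemma (in prob_space) small_resolvent_area_tendsto_0:
  fixes X :: "nat \<Rightarrow> 'a \<Rightarrow> complex" and R \<delta> :: real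
  assumes indep: "indep_vars (\<lambda>_. borel) X UNIV"
    and distr: "\<And>j. distr M borel (X j) = \<mu>"
    and nondeg: "\<And>u. \<not> (AE x in \<mu>. x = u)"
    and m: "filterlim m at_top sequentially"
    and c: "\<And>n. c n \<in> borel_measurable borel"
    and \<delta>: "\<delta> > 0"
  defines "A \<equiv> \<lambda>n. {\<omega> \<in> space M. \<delta> \<le> measure lborel
    {z \<in> cball 0 R. cmod ((\<Sum>j<m n. inverse (z - X j \<omega>)) + c n z) < 1}}"
  shows "A n \<in> events" and "(\<lambda>n. prob (A n)) \<longlonglongrightarrow> 0"
proof -
  have X [measurable]: "X j \<in> borel_measurable M" for j using indep by (auto simp: indep_vars_def)
  note c [measurable]
  interpret P: pair_sigma_finite M "lborel :: complex measure" ..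
  define G where "G = (\<lambda>n. {x \<in> space (M \<Otimes>\<^sub>M lborel). snd x \<in> cball 0 R \<and>
      cmod ((\<Sum>j<m n. inverse (snd x - X j (fst x))) + c n (snd x)) < 1})"
  have G: "G n \<in> sets (M \<Otimes>\<^sub>M lborel)" for n
    unfolding G_def by measurable
  define S where "S = (\<lambda>n \<omega>. {z \<in> cball 0 R. cmod ((\<Sum>j<m n. inverse (z - X j \<omega>)) + c n z) < 1})"
  have PG: "Pair \<omega> -` G n = S n \<omega>" if "\<omega> \<in> space M" for \<omega> n
    using that by (auto simp: G_def S_def space_pair_measure)
  have S: "S n \<omega> \<in> sets borel" if "\<omega> \<in> space M" for \<omega> n
    using sets_Pair1[OF G[of n], of \<omega>] PG[OF that] by simp
  have Sfin: "emeasure lborel (S n \<omega>) < \<infinity>" for n \<omega>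
    by (rule emeasure_bounded_finite) (auto simp: S_def intro: bounded_subset[of "cball 0 R"])
  have em: "emeasure lborel (S n \<omega>) = ennreal (measure lborel (S n \<omega>))" for n \<omega>
    using Sfin[of n \<omega>] by (intro emeasure_eq_ennreal_measure) auto
  have meas: "(\<lambda>\<omega>. emeasure lborel (S n \<omega>)) \<in> borel_measurable M" for n
    using lborel.measurable_emeasure_Pair[OF G[of n]] PG by (simp cong: measurable_cong)
  have A_S: "A n = {\<omega> \<in> space M. \<delta> \<le> measure lborel (S n \<omega>)}" for n
    by (simp only: A_def S_def)
  have A_eq: "A n = {\<omega> \<in> space M. ennreal \<delta> \<le> emeasure lborel (S n \<omega>)}" for n
    using \<delta> by (auto simp: A_S em)
  show ev: "A n \<in> events" for n
    unfolding A_eq using meas[of n] by measurable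
  have "(\<lambda>n. emeasure (M \<Otimes>\<^sub>M lborel) (G n)) \<longlonglongrightarrow> (\<integral>\<^sup>+z. 0 \<partial>(lborel :: complex measure))"
    unfolding P.emeasure_pair_measure_alt2[OF G]
  proof (rule nn_integral_dominated_convergence[where w = "indicator (cball 0 R)"])
    show "(\<lambda>z. emeasure M ((\<lambda>\<omega>. (\<omega>, z)) -` G n)) \<in> borel_measurable lborel" for n
      using P.measurable_emeasure_Pair2[OF G[of n]] .
    show "(\<integral>\<^sup>+z. indicator (cball 0 R) z \<partial>(lborel :: complex measure)) < \<infinity>"
      using emeasure_compact_finite[of "cball (0::complex) R"] by simp
    show "AE z in lborel. emeasure M ((\<lambda>\<omega>. (\<omega>, z)) -` G n) \<le> indicator (cball 0 R) z" for n
    proof (rule AE_I2)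
      fix z show "emeasure M ((\<lambda>\<omega>. (\<omega>, z)) -` G n) \<le> indicator (cball 0 R) z"
      proof (cases "z \<in> cball 0 R")
        case False
        hence "(\<lambda>\<omega>. (\<omega>, z)) -` G n = {}" by (auto simp: G_def)
        thus ?thesis by simp
      qed (use emeasure_le_1 in auto)
    qed
    show "AE z in lborel. (\<lambda>n. emeasure M ((\<lambda>\<omega>. (\<omega>, z)) -` G n)) \<longlonglongrightarrow> 0"
    proof (rule AE_I2)
      fix z :: complex
      let ?E = "\<lambda>n. {\<omega> \<in> space M. cmod ((\<Sum>j<m n. inverse (z - X j \<omega>)) + c n z) < 1}"
      have le: "emeasure M ((\<lambda>\<omega>. (\<omega>, z)) -` G n) \<le> ennreal (prob (?E n))" for n
        unfolding emeasure_eq_measure[symmetric]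
        by (rule emeasure_mono) (auto simp: G_def space_pair_measure)
      have "(\<lambda>n. ennreal (prob (?E n))) \<longlonglongrightarrow> ennreal 0"
        by (intro tendsto_ennrealI resolvent_sum_concentration_tendsto_0[OF indep distr nondeg m])
      hence "(\<lambda>n. ennreal (prob (?E n))) \<longlonglongrightarrow> 0" by simp
      from tendsto_sandwich[OF _ _ tendsto_const this]
      show "(\<lambda>n. emeasure M ((\<lambda>\<omega>. (\<omega>, z)) -` G n)) \<longlonglongrightarrow> 0"
        using le by auto
    qed
  qed auto
  hence limG: "(\<lambda>n. emeasure (M \<Otimes>\<^sub>M lborel) (G n)) \<longlonglongrightarrow> 0" by simp
  have le: "ennreal (prob (A n)) \<le> ennreal (1 / \<delta>) * emeasure (M \<Otimes>\<^sub>M lborel) (G n)" for n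
  proof -
    have "A n \<subseteq> {\<omega> \<in> space M. 1 \<le> ennreal (1 / \<delta>) * emeasure lborel (S n \<omega>)}"
      using \<delta> by (auto simp: A_S em simp flip: ennreal_mult ennreal_1)
    hence "emeasure M (A n) \<le> emeasure M {\<omega> \<in> space M. 1 \<le> ennreal (1 / \<delta>) * emeasure lborel (S n \<omega>)}"
      using meas[of n] by (intro emeasure_mono) auto
    also have "\<dots> \<le> ennreal (1 / \<delta>) * (\<integral>\<^sup>+\<omega>. emeasure lborel (S n \<omega>) * indicator (space M) \<omega> \<partial>M)"
      by (rule nn_integral_Markov_inequality) (use meas[of n] in auto)
    also have "(\<integral>\<^sup>+\<omega>. emeasure lborel (S n \<omega>) * indicator (space M) \<omega> \<partial>M) = emeasure (M \<Otimes>\<^sub>M lborel) (G n)"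
      unfolding lborel.emeasure_pair_measure_alt[OF G] using PG by (intro nn_integral_cong) auto
    finally show ?thesis by (simp add: emeasure_eq_measure)
  qed
  have "(\<lambda>n. ennreal (1 / \<delta>) * emeasure (M \<Otimes>\<^sub>M lborel) (G n)) \<longlonglongrightarrow> ennreal (1 / \<delta>) * 0"
    by (intro ennreal_tendsto_cmult limG) auto
  from tendsto_sandwich[OF _ _ tendsto_const this]
  have "(\<lambda>n. ennreal (prob (A n))) \<longlonglongrightarrow> ennreal 0" using le by auto
  thus "(\<lambda>n. prob (A n)) \<longlonglongrightarrow> 0" by (subst (asm) tendsto_ennreal_iff) auto
qed

text \<open>Hoeffding's inequality for values in [-b, b] gives a bound that decays exponentially in
  the number of summands.\<close>

lemma (in prob_space) weak_law_bounded_iid: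
  fixes X :: "nat \<Rightarrow> 'a \<Rightarrow> 'b::topological_space" and f :: "'b \<Rightarrow> real"
  assumes indep: "indep_vars (\<lambda>_. borel) X UNIV"
    and distr: "\<And>j. distr M borel (X j) = \<mu>"
    and f [measurable]: "f \<in> borel_measurable borel" and B: "\<And>x. \<bar>f x\<bar> \<le> B"
    and m: "filterlim m at_top sequentially" and \<epsilon>: "\<epsilon> > 0"
  shows "(\<lambda>n. prob {\<omega> \<in> space M. \<epsilon> \<le> \<bar>(\<Sum>j<m n. f (X j \<omega>)) / real (m n) - integral\<^sup>L \<mu> f\<bar>}) \<longlonglongrightarrow> 0"
proof -
  have X [measurable]: "X j \<in> borel_measurable M" for j using indep by (auto simp: indep_vars_def)
  \<comment> \<open>\<open>B\<close> may be 0, and Hoeffding's inequality asks for a nondegenerate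
    interval.\<close>
  define b where "b = B + 1"
  have b: "b > 0" "\<And>x. \<bar>f x\<bar> \<le> b"
    using order_trans[OF abs_ge_zero B] order_trans[OF B, of b] by (auto simp: b_def)
  have fb: "f x \<in> {-b..b}" for x using b(2)[of x] by (auto simp: abs_le_iff)
  have indepf: "indep_vars (\<lambda>_. borel) (\<lambda>j \<omega>. f (X j \<omega>)) UNIV"
    by (rule indep_vars_compose2[OF indep]) measurable
  have distrf: "distr M borel (\<lambda>\<omega>. f (X j \<omega>)) = distr \<mu> borel f" for j
    unfolding distr[of j, symmetric] by (subst distr_distr) (auto simp: o_def)
  have le: "prob {\<omega> \<in> space M. \<epsilon> \<le> \<bar>(\<Sum>j<k. f (X j \<omega>)) / real k - integral\<^sup>L \<mu> f\<bar>}
      \<le> 2 * exp (-2 * real k * \<epsilon>\<^sup>2 / (b - (- b))\<^sup>2)" if "k > 0" for k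
  proof -
    interpret H: Hoeffding_ineq_iid M "{..<k}" "\<lambda>j \<omega>. f (X j \<omega>)" "\<lambda>\<omega>. f (X 0 \<omega>)" "-b" b "expectation (\<lambda>\<omega>. f (X 0 \<omega>))"
    proof unfold_locales
      show "indep_vars (\<lambda>_. borel) (\<lambda>j \<omega>. f (X j \<omega>)) {..<k}"
        by (rule indep_vars_subset[OF indepf]) auto
    qed (use fb in \<open>simp_all add: distrf\<close>)
    have E: "expectation (\<lambda>\<omega>. f (X 0 \<omega>)) = integral\<^sup>L \<mu> f"
      unfolding distr[of 0, symmetric] by (subst integral_distr) auto
    have "\<epsilon> \<ge> 0" "- b < b" "{..<k} \<noteq> {}" using b \<epsilon> that by auto
    from H.Hoeffding_ineq_abs_ge'[OF this] show ?thesis unfolding card_lessThan E .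
  qed
  have "filterlim (\<lambda>n. real (m n)) at_top sequentially"
    using filterlim_compose[OF filterlim_real_sequentially m] .
  moreover have "((\<lambda>x. 2 * exp (-2 * x * \<epsilon>\<^sup>2 / (b - (- b))\<^sup>2)) \<longlongrightarrow> 0) at_top"
    using \<epsilon> b by real_asymp
  ultimately have lim: "(\<lambda>n. 2 * exp (-2 * real (m n) * \<epsilon>\<^sup>2 / (b - (- b))\<^sup>2)) \<longlonglongrightarrow> 0"
    using filterlim_compose by blast
  have "\<forall>\<^sub>F n in sequentially. m n > 0"
    by (rule eventually_compose_filterlim[OF eventually_gt_at_top m])
  hence "\<forall>\<^sub>F n in sequentially. prob {\<omega> \<in> space M. \<epsilon> \<le> \<bar>(\<Sum>j<m n. f (X j \<omega>)) / real (m n) - integral\<^sup>L \<mu> f\<bar>}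
      \<le> 2 * exp (-2 * real (m n) * \<epsilon>\<^sup>2 / (b - (- b))\<^sup>2)"
    by eventually_elim (use le in auto)
  thus ?thesis by (intro tendsto_sandwich[OF _ _ tendsto_const lim]) auto
qed

section \<open>Convergence in probability\<close>

lemma sum_mset_eq_sum_count:
  fixes f :: "'a \<Rightarrow> real"
  shows "(\<Sum>x\<in>#A. f x) = (\<Sum>x\<in>set_mset A. real (count A x) * f x)"
proof (induction A)
  case (add a A)
  have "(\<Sum>x\<in>set_mset (add_mset a A). real (count (add_mset a A) x) * f x)
     = (\<Sum>x\<in>insert a (set_mset A). real (count A x) * f x + (if x = a then f x else 0))"
    by (intro sum.cong) (auto simp: algebra_simps)
  also have "\<dots> = (\<Sum>x\<in>insert a (set_mset A). real (count A x) * f x) + f a"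
    by (simp add: sum.distrib sum.delta)
  also have "(\<Sum>x\<in>insert a (set_mset A). real (count A x) * f x) = (\<Sum>x\<in>set_mset A. real (count A x) * f x)"
    by (intro sum.mono_neutral_right) (auto simp: not_in_iff)
  finally show ?case using add by simp
qed auto

text \<open>Multiplicities of the zeros of p' become counts in the multiset \<open>proots\<close>,
  and p' has degree one less than p. In degree 1 both sides are 0, by division by zero.\<close>

lemma crit_integral_eq_sum_mset:
  assumes "degree p \<ge> 1"
  shows "crit_integral p f = (\<Sum>y\<in>#proots (pderiv p). f y) / (real (degree p) - 1)"
  using pderiv_neq_0[OF assms] assms
  by (simp add: crit_integral_def root_integral_def sum_mset_eq_sum_count degree_pderiv of_nat_diff)

lemma proots_pn:
  "proots (pn k \<xi> x n) = (\<Sum>j<n - k n. {#x j#}) + (\<Sum>l<k n. {#\<xi> n l#})"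
  by (simp add: pn_def proots_mult proots_prod)

lemma sum_mset_sum: "(\<Sum>y\<in>#(\<Sum>j\<in>J. A j). f y) = (\<Sum>j\<in>J. \<Sum>y\<in>#A j. f y)"
  for f :: "'a \<Rightarrow> 'b::comm_monoid_add"
  by (induction J rule: infinite_finite_induct) auto

lemma sum_mset_proots_pn:
  fixes h :: "complex \<Rightarrow> 'b::comm_monoid_add"
  shows "(\<Sum>y\<in>#proots (pn k \<xi> x n). h y) = (\<Sum>j<n - k n. h (x j)) + (\<Sum>l<k n. h (\<xi> n l))"
  by (simp add: proots_pn sum_mset_sum)

lemma lead_coeff_pn: "lead_coeff (pn k \<xi> x n) = 1"
  by (simp add: pn_def lead_coeff_mult lead_coeff_prod)

lemma degree_pn: "k n \<le> n \<Longrightarrow> degree (pn k \<xi> x n) = n"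
  by (simp flip: size_proots_complex add: proots_pn size_multiset_sum)

lemma abs_sum_mset_le:
  fixes f :: "'a \<Rightarrow> real"
  assumes "\<And>x. \<bar>f x\<bar> \<le> B"
  shows "\<bar>\<Sum>x\<in>#A. f x\<bar> \<le> B * real (size A)"
proof (induction A)
  case (add a A)
  thus ?case using assms[of a] by (simp add: algebra_simps)
qed auto

text \<open>No measurability of D is required: the exceptional set is only covered by an event.\<close>

definition tendsto_0_in_prob :: "'a measure \<Rightarrow> (nat \<Rightarrow> 'a \<Rightarrow> real) \<Rightarrow> bool" where
  "tendsto_0_in_prob M D \<longleftrightarrow> (\<forall>\<epsilon>>0. \<forall>\<delta>>0. \<forall>\<^sub>F n in sequentially.
     \<exists>A\<in>sets M. {\<omega> \<in> space M. \<bar>D n \<omega>\<bar> > \<epsilon>} \<subseteq> A \<and> measure M A < \<delta>)"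

section \<open>Rules for convergence in probability with covering events\<close>

lemma tendsto_0_in_probI:
  assumes "\<And>\<epsilon>. \<epsilon> > 0 \<Longrightarrow> \<exists>A. (\<forall>n. A n \<in> sets M) \<and> (\<lambda>n. measure M (A n)) \<longlonglongrightarrow> 0 \<and>
      (\<forall>\<^sub>F n in sequentially. {\<omega> \<in> space M. \<bar>D n \<omega>\<bar> > \<epsilon>} \<subseteq> A n)"
  shows "tendsto_0_in_prob M D"
  unfolding tendsto_0_in_prob_def
proof (intro allI impI)
  fix \<epsilon> \<delta> :: real assume "\<epsilon> > 0" "\<delta> > 0"
  from assms[OF this(1)] obtain A where A: "\<And>n. A n \<in> sets M" "(\<lambda>n. measure M (A n)) \<longlonglongrightarrow> 0"
      "\<forall>\<^sub>F n in sequentially. {\<omega> \<in> space M. \<bar>D n \<omega>\<bar> > \<epsilon>} \<subseteq> A n" by blast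
  from order_tendstoD(2)[OF A(2) \<open>\<delta> > 0\<close>] A(3)
  show "\<forall>\<^sub>F n in sequentially. \<exists>A\<in>sets M. {\<omega> \<in> space M. \<bar>D n \<omega>\<bar> > \<epsilon>} \<subseteq> A \<and> measure M A < \<delta>"
    by eventually_elim (use A(1) in blast)
qed

lemma (in prob_space) tendsto_0_in_prob_add:
  assumes "tendsto_0_in_prob M D" "tendsto_0_in_prob M E"
  shows "tendsto_0_in_prob M (\<lambda>n \<omega>. D n \<omega> + E n \<omega>)"
  unfolding tendsto_0_in_prob_def
proof (intro allI impI)
  fix \<epsilon> \<delta> :: real assume "\<epsilon> > 0" "\<delta> > 0"
  hence pos: "\<epsilon> / 2 > 0" "\<delta> / 2 > 0" by auto
  have "\<forall>\<^sub>F n in sequentially. \<exists>A\<in>sets M. {\<omega> \<in> space M. \<bar>D n \<omega>\<bar> > \<epsilon> / 2} \<subseteq> A \<and> measure M A < \<delta> / 2"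
       "\<forall>\<^sub>F n in sequentially. \<exists>A\<in>sets M. {\<omega> \<in> space M. \<bar>E n \<omega>\<bar> > \<epsilon> / 2} \<subseteq> A \<and> measure M A < \<delta> / 2"
    using assms pos unfolding tendsto_0_in_prob_def by blast+
  thus "\<forall>\<^sub>F n in sequentially. \<exists>A\<in>sets M. {\<omega> \<in> space M. \<bar>D n \<omega> + E n \<omega>\<bar> > \<epsilon>} \<subseteq> A \<and> measure M A < \<delta>"
  proof eventually_elim
    case (elim n)
    then obtain A B where A: "A \<in> sets M" "{\<omega> \<in> space M. \<bar>D n \<omega>\<bar> > \<epsilon> / 2} \<subseteq> A" "measure M A < \<delta> / 2"
      and B: "B \<in> sets M" "{\<omega> \<in> space M. \<bar>E n \<omega>\<bar> > \<epsilon> / 2} \<subseteq> B" "measure M B < \<delta> / 2" by blast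
    have "{\<omega> \<in> space M. \<bar>D n \<omega> + E n \<omega>\<bar> > \<epsilon>} \<subseteq> A \<union> B"
    proof safe
      fix \<omega> assume \<omega>: "\<omega> \<in> space M" "\<bar>D n \<omega> + E n \<omega>\<bar> > \<epsilon>" "\<omega> \<notin> B"
      hence "\<not> \<bar>E n \<omega>\<bar> > \<epsilon> / 2" using B by blast
      hence "\<bar>D n \<omega>\<bar> > \<epsilon> / 2" using \<omega>(2) by linarith
      thus "\<omega> \<in> A" using A \<omega>(1) by blast
    qed
    moreover have "measure M (A \<union> B) < \<delta>"
      using measure_Un_le[OF A(1) B(1)] A(3) B(3) by linarith
    ultimately show ?case using A(1) B(1) by blast
  qed
qed

lemma tendsto_0_in_prob_mono:
  assumes "tendsto_0_in_prob M E"
    and "\<forall>\<^sub>F n in sequentially. \<forall>\<omega>\<in>space M. \<bar>D n \<omega>\<bar> \<le> \<bar>E n \<omega>\<bar>"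
  shows "tendsto_0_in_prob M D"
  unfolding tendsto_0_in_prob_def
proof (intro allI impI)
  fix \<epsilon> \<delta> :: real assume "\<epsilon> > 0" "\<delta> > 0"
  with assms(1) have "\<forall>\<^sub>F n in sequentially. \<exists>A\<in>sets M. {\<omega> \<in> space M. \<bar>E n \<omega>\<bar> > \<epsilon>} \<subseteq> A \<and> measure M A < \<delta>"
    unfolding tendsto_0_in_prob_def by blast
  with assms(2) show "\<forall>\<^sub>F n in sequentially. \<exists>A\<in>sets M. {\<omega> \<in> space M. \<bar>D n \<omega>\<bar> > \<epsilon>} \<subseteq> A \<and> measure M A < \<delta>"
  proof eventually_elim
    case (elim n)
    have "{\<omega> \<in> space M. \<bar>D n \<omega>\<bar> > \<epsilon>} \<subseteq> {\<omega> \<in> space M. \<bar>E n \<omega>\<bar> > \<epsilon>}"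
      using elim(1) by fastforce
    thus ?case using elim(2) by (meson subset_trans)
  qed
qed

lemma tendsto_0_in_prob_const:
  assumes "u \<longlonglongrightarrow> 0" shows "tendsto_0_in_prob M (\<lambda>n \<omega>. u n)"
proof (rule tendsto_0_in_probI)
  fix \<epsilon> :: real assume "\<epsilon> > 0"
  hence "\<forall>\<^sub>F n in sequentially. \<bar>u n\<bar> < \<epsilon>"
    using assms by (auto dest!: tendstoD[of _ _ _ \<epsilon>] simp: dist_real_def)
  hence "\<forall>\<^sub>F n in sequentially. {\<omega> \<in> space M. \<bar>u n\<bar> > \<epsilon>} \<subseteq> {}"
    by eventually_elim auto
  thus "\<exists>A. (\<forall>n. A n \<in> sets M) \<and> (\<lambda>n. measure M (A n)) \<longlonglongrightarrow> 0 \<and>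
      (\<forall>\<^sub>F n in sequentially. {\<omega> \<in> space M. \<bar>u n\<bar> > \<epsilon>} \<subseteq> A n)"
    by (intro exI[of _ "\<lambda>_. {}"]) auto
qed

lemma tendsto_0_in_prob_cmult:
  assumes "tendsto_0_in_prob M D" and b: "b \<ge> 0"
  shows "tendsto_0_in_prob M (\<lambda>n \<omega>. b * D n \<omega>)"
  unfolding tendsto_0_in_prob_def
proof (intro allI impI)
  fix \<epsilon> \<delta> :: real assume \<epsilon>: "\<epsilon> > 0" and "\<delta> > 0"
  \<comment> \<open>\<open>b + 1\<close> in place of b avoids a division by zero when b = 0.\<close>
  hence "\<epsilon> / (b + 1) > 0" using b by simp
  with assms(1) \<open>\<delta> > 0\<close> have "\<forall>\<^sub>F n in sequentially. \<exists>A\<in>sets M. {\<omega> \<in> space M. \<bar>D n \<omega>\<bar> > \<epsilon> / (b + 1)} \<subseteq> A \<and> measure M A < \<delta>"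
    unfolding tendsto_0_in_prob_def by blast
  thus "\<forall>\<^sub>F n in sequentially. \<exists>A\<in>sets M. {\<omega> \<in> space M. \<bar>b * D n \<omega>\<bar> > \<epsilon>} \<subseteq> A \<and> measure M A < \<delta>"
  proof eventually_elim
    case (elim n)
    have "{\<omega> \<in> space M. \<bar>b * D n \<omega>\<bar> > \<epsilon>} \<subseteq> {\<omega> \<in> space M. \<bar>D n \<omega>\<bar> > \<epsilon> / (b + 1)}"
    proof safe
      fix \<omega> assume "\<bar>b * D n \<omega>\<bar> > \<epsilon>"
      hence "\<epsilon> < b * \<bar>D n \<omega>\<bar>" using b by (simp add: abs_mult)
      also have "\<dots> \<le> (b + 1) * \<bar>D n \<omega>\<bar>" by (simp add: algebra_simps)
      finally show "\<bar>D n \<omega>\<bar> > \<epsilon> / (b + 1)" using b by (simp add: field_simps)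
    qed
    thus ?case using elim by (meson subset_trans)
  qed
qed

lemma smallo_diff_at_top:
  assumes "(\<lambda>n. real (k n)) \<in> o(\<lambda>n. real n)"
  shows "filterlim (\<lambda>n. n - k n) at_top sequentially"
proof (rule filterlim_at_top_mono)
  have "\<forall>\<^sub>F n in sequentially. norm (real (k n)) \<le> 1/2 * norm (real n)"
    by (rule landau_o.smallD[OF assms]) simp
  thus "\<forall>\<^sub>F n in sequentially. n div 2 \<le> n - k n"
  proof eventually_elim
    case (elim n)
    hence "real (2 * k n) \<le> real n" by simp
    hence "2 * k n \<le> n" by (simp only: of_nat_le_iff)
    thus ?case by linarith
  qed
  show "filterlim (\<lambda>n::nat. n div 2) at_top sequentially"
    unfolding filterlim_at_top
  proof
    fix Z :: nat
    show "\<forall>\<^sub>F n in sequentially. Z \<le> n div 2"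
      using eventually_ge_at_top[of "2 * Z"] by eventually_elim auto
  qed
qed

text \<open>Outside the event that the part of the disc with |L| < 1 has area at least \<delta>, the
  deterministic estimates leave a deviation of at most 3 \<epsilon> / 8 + u n. The comparison is
  with the mean over all n roots, the deterministic ones included.\<close>

lemma (in prob_space) crit_integral_minus_root_mean_in_prob:
  fixes X :: "nat \<Rightarrow> 'a \<Rightarrow> complex" and f :: "complex \<Rightarrow> real"
  assumes indep: "indep_vars (\<lambda>_. borel) X UNIV"
    and distr: "\<And>j. distr M borel (X j) = \<mu>"
    and nondeg: "\<And>u. \<not> (AE x in \<mu>. x = u)"
    and k: "\<And>n. k n \<le> n" "(\<lambda>n. real (k n)) \<in> o(\<lambda>n. real n)"
    and f: "continuous_on UNIV f" and supp: "\<And>z. cmod z > \<rho> \<Longrightarrow> f z = 0"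
    and B: "\<And>z. \<bar>f z\<bar> \<le> B"
  shows "tendsto_0_in_prob M (\<lambda>n \<omega>. crit_integral (pn k \<xi> (\<lambda>j. X j \<omega>) n) f
           - (\<Sum>y\<in>#proots (pn k \<xi> (\<lambda>j. X j \<omega>) n). f y) / real n)"
proof (rule tendsto_0_in_probI)
  fix \<epsilon> :: real assume \<epsilon>: "\<epsilon> > 0"
  hence \<epsilon>8: "\<epsilon> / 8 > 0" by simp
  obtain R C where R: "R > 0" and C: "C \<ge> 0" and bound: "\<And>p. lead_coeff p = 1 \<Longrightarrow> degree p \<ge> 1 \<Longrightarrow>
      \<bar>(\<Sum>y\<in>#proots (pderiv p). f y) - (\<Sum>x\<in>#proots p. f x)\<bar>
        \<le> 2 * (\<epsilon> / 8) * real (degree p)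
          + C * ((LINT z:cball 0 R|lborel. \<bar>ln (cmod (log_deriv p z))\<bar>) + ln (real (degree p)))"
    using critical_sum_minus_root_sum_le[OF f supp \<epsilon>8] by blast
  \<comment> \<open>\<open>C + 1\<close> keeps the quotient meaningful for C = 0, and C * \<eta>
    stays at most \<epsilon> / 8.\<close>
  define \<eta> where "\<eta> = \<epsilon> / (8 * (C + 1))"
  have \<eta>: "\<eta> > 0" "C * \<eta> \<le> \<epsilon> / 8" using \<epsilon> C by (auto simp: \<eta>_def field_simps)
  obtain \<delta> N where \<delta>: "\<delta> > 0" and small: "\<And>p. lead_coeff p = 1 \<Longrightarrow> degree p \<ge> N \<Longrightarrow>
    measure lborel {z \<in> cball 0 R. cmod (log_deriv p z) < 1} < \<delta> \<Longrightarrow>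
    (LINT z:cball 0 R|lborel. \<bar>ln (cmod (log_deriv p z))\<bar>) \<le> \<eta> * real (degree p)"
    using log_deriv_L1_small[OF R \<eta>(1)] by blast
  define c where "c = (\<lambda>n z. \<Sum>l<k n. inverse (z - \<xi> n l))"
  have c: "c n \<in> borel_measurable borel" for n unfolding c_def by measurable
  define A where "A = (\<lambda>n. {\<omega> \<in> space M. \<delta> \<le> measure lborel
    {z \<in> cball 0 R. cmod ((\<Sum>j<n - k n. inverse (z - X j \<omega>)) + c n z) < 1}})"
  have A: "A n \<in> events" "(\<lambda>n. prob (A n)) \<longlonglongrightarrow> 0" for n
    unfolding A_def
    by (rule small_resolvent_area_tendsto_0[OF indep distr nondeg smallo_diff_at_top[OF k(2)] c \<delta>])+
  \<comment> \<open>Vanishing errors: C ln n / n from the leading coefficient of p', and B / n from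
    dividing the critical sum by n - 1 instead of n. Once u n < \<epsilon> / 2, adding 2 \<epsilon>
    / 8 from the kernel and \<epsilon> / 8 from the area integral still stays below
    \<epsilon>.\<close>
  define u where "u = (\<lambda>n::nat. C * ln (real n) / real n + B / real n)"
  have "(\<lambda>n. ln (real n) / real n) \<longlonglongrightarrow> 0" by real_asymp
  moreover have "(\<lambda>n. 1 / real n) \<longlonglongrightarrow> 0" by real_asymp
  ultimately have "(\<lambda>n. C * (ln (real n) / real n) + B * (1 / real n)) \<longlonglongrightarrow> C * 0 + B * 0"
    by (intro tendsto_intros)
  hence "u \<longlonglongrightarrow> 0" by (simp add: u_def)
  hence "\<forall>\<^sub>F n in sequentially. u n < \<epsilon> / 2" using \<epsilon> by (intro order_tendstoD(2)) auto
  hence "\<forall>\<^sub>F n in sequentially. {\<omega> \<in> space M. \<bar>crit_integral (pn k \<xi> (\<lambda>j. X j \<omega>) n) f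
           - (\<Sum>y\<in>#proots (pn k \<xi> (\<lambda>j. X j \<omega>) n). f y) / real n\<bar> > \<epsilon>} \<subseteq> A n"
    using eventually_ge_at_top[of N] eventually_ge_at_top[of 2]
  proof eventually_elim
    case (elim n)
    show ?case
    proof (rule subsetI, rule ccontr)
      fix \<omega> assume "\<omega> \<in> {\<omega> \<in> space M. \<bar>crit_integral (pn k \<xi> (\<lambda>j. X j \<omega>) n) f
           - (\<Sum>y\<in>#proots (pn k \<xi> (\<lambda>j. X j \<omega>) n). f y) / real n\<bar> > \<epsilon>}" and "\<omega> \<notin> A n"
      hence \<omega>: "\<omega> \<in> space M" "\<omega> \<notin> A n" and gt: "\<bar>crit_integral (pn k \<xi> (\<lambda>j. X j \<omega>) n) f
           - (\<Sum>y\<in>#proots (pn k \<xi> (\<lambda>j. X j \<omega>) n). f y) / real n\<bar> > \<epsilon>" by auto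
      define p where "p = pn k \<xi> (\<lambda>j. X j \<omega>) n"
      have p: "lead_coeff p = 1" "degree p = n" unfolding p_def by (rule lead_coeff_pn, rule degree_pn[OF k(1)])
      \<comment> \<open>The deterministic roots enter only through the shift
        \<open>c n z\<close>.\<close>
      have ld: "log_deriv p z = (\<Sum>j<n - k n. inverse (z - X j \<omega>)) + c n z" for z
        by (simp add: log_deriv_def p_def sum_mset_proots_pn c_def)
      define I where "I = (LINT z:cball 0 R|lborel. \<bar>ln (cmod (log_deriv p z))\<bar>)"
      have "I \<le> \<eta> * real n"
        unfolding I_def p(2)[symmetric]
        by (rule small) (use p elim \<omega> in \<open>auto simp: A_def ld simp del: mem_cball mem_cball_0\<close>)
      hence CI: "C * I \<le> \<epsilon> / 8 * real n"
        using mult_left_mono[of I "\<eta> * real n" C] mult_right_mono[OF \<eta>(2), of "real n"] C by (simp add: mult_ac)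
      define Sc where "Sc = (\<Sum>y\<in>#proots (pderiv p). f y)"
      define Sr where "Sr = (\<Sum>x\<in>#proots p. f x)"
      have n: "real n \<ge> 2" using elim by simp
      have "\<bar>Sc - Sr\<bar> \<le> 2 * (\<epsilon> / 8) * real n + C * (I + ln (real n))"
        using bound[of p] p elim by (simp add: Sc_def Sr_def I_def)
      also have "\<dots> \<le> 3 / 8 * \<epsilon> * real n + C * ln (real n)" using CI by (simp add: algebra_simps)
      finally have "\<bar>Sc - Sr\<bar> / real n \<le> (3 / 8 * \<epsilon> * real n + C * ln (real n)) / real n"
        by (rule divide_right_mono) simp
      also have "\<dots> = 3 / 8 * \<epsilon> + C * ln (real n) / real n" using n by (simp add: field_simps)
      finally have 1: "\<bar>Sc / real n - Sr / real n\<bar> \<le> 3 / 8 * \<epsilon> + C * ln (real n) / real n"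
        by (simp add: diff_divide_distrib[symmetric] abs_divide)
      have "\<bar>Sc\<bar> \<le> B * real (size (proots (pderiv p)))" unfolding Sc_def by (rule abs_sum_mset_le[OF B])
      also have "real (size (proots (pderiv p))) = real n - 1"
        using elim p by (simp add: size_proots_complex degree_pderiv of_nat_diff)
      finally have Sc: "\<bar>Sc\<bar> \<le> B * (real n - 1)" .
      have "Sc / (real n - 1) - Sc / real n = (Sc / (real n - 1)) / real n"
        using n by (simp add: field_simps)
      hence "\<bar>Sc / (real n - 1) - Sc / real n\<bar> = (\<bar>Sc\<bar> / (real n - 1)) / real n"
        using n by (simp add: abs_divide)
      also have "\<dots> \<le> B / real n"
        using Sc n by (intro divide_right_mono) (auto simp: field_simps)
      finally have 2: "\<bar>Sc / (real n - 1) - Sc / real n\<bar> \<le> B / real n" .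
      have "crit_integral p f = Sc / (real n - 1)"
        using crit_integral_eq_sum_mset[of p f] p elim by (simp add: Sc_def)
      hence "\<epsilon> < \<bar>Sc / (real n - 1) - Sr / real n\<bar>" using gt by (simp add: p_def Sr_def)
      thus False using 1 2 elim(1) \<epsilon> unfolding u_def by linarith
    qed
  qed
  thus "\<exists>A. (\<forall>n. A n \<in> events) \<and> (\<lambda>n. prob (A n)) \<longlonglongrightarrow> 0 \<and>
      (\<forall>\<^sub>F n in sequentially. {\<omega> \<in> space M. \<bar>crit_integral (pn k \<xi> (\<lambda>j. X j \<omega>) n) f
           - (\<Sum>y\<in>#proots (pn k \<xi> (\<lambda>j. X j \<omega>) n). f y) / real n\<bar> > \<epsilon>} \<subseteq> A n)"
    using A by blast
qed

text \<open>The deviation is split in three: critical points against all roots, all roots against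
  the random ones, and the weak law for the random ones. The middle replacement costs at most 2 B
  k_n / n: half of it from the k_n deterministic roots, half from the change of
  normalisation.\<close>

lemma (in prob_space) crit_integral_compact_support_in_prob:
  fixes X :: "nat \<Rightarrow> 'a \<Rightarrow> complex" and f :: "complex \<Rightarrow> real"
  assumes indep: "indep_vars (\<lambda>_. borel) X UNIV"
    and distr: "\<And>j. distr M borel (X j) = \<mu>"
    and nondeg: "\<And>u. \<not> (AE x in \<mu>. x = u)"
    and k: "\<And>n. k n \<le> n" "(\<lambda>n. real (k n)) \<in> o(\<lambda>n. real n)"
    and f: "continuous_on UNIV f" and supp: "\<And>z. cmod z > \<rho> \<Longrightarrow> f z = 0"
    and B: "\<And>z. \<bar>f z\<bar> \<le> B"
  shows "tendsto_0_in_prob M (\<lambda>n \<omega>. crit_integral (pn k \<xi> (\<lambda>j. X j \<omega>) n) f - integral\<^sup>L \<mu> f)"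
proof -
  have X [measurable]: "X j \<in> borel_measurable M" for j using indep by (auto simp: indep_vars_def)
  have fm [measurable]: "f \<in> borel_measurable borel" using f by (rule borel_measurable_continuous_onI)
  note lim = smallo_diff_at_top[OF k(2)]
  have B0: "B \<ge> 0" using order_trans[OF abs_ge_zero B] .
  define S where "S = (\<lambda>n \<omega>. \<Sum>j<n - k n. f (X j \<omega>))"
  define Z where "Z = (\<lambda>n \<omega>. \<Sum>y\<in>#proots (pn k \<xi> (\<lambda>j. X j \<omega>) n). f y)"
  have 1: "tendsto_0_in_prob M (\<lambda>n \<omega>. crit_integral (pn k \<xi> (\<lambda>j. X j \<omega>) n) f - Z n \<omega> / real n)"
    unfolding Z_def by (rule crit_integral_minus_root_mean_in_prob) fact+
  have 2: "tendsto_0_in_prob M (\<lambda>n \<omega>. S n \<omega> / real (n - k n) - integral\<^sup>L \<mu> f)"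
  proof (rule tendsto_0_in_probI)
    fix \<epsilon> :: real assume "\<epsilon> > 0"
    from weak_law_bounded_iid[OF indep distr fm B lim this]
    have "(\<lambda>n. prob {\<omega> \<in> space M. \<epsilon> \<le> \<bar>S n \<omega> / real (n - k n) - integral\<^sup>L \<mu> f\<bar>}) \<longlonglongrightarrow> 0"
      by (simp add: S_def)
    thus "\<exists>A. (\<forall>n. A n \<in> events) \<and> (\<lambda>n. prob (A n)) \<longlonglongrightarrow> 0 \<and>
      (\<forall>\<^sub>F n in sequentially. {\<omega> \<in> space M. \<bar>S n \<omega> / real (n - k n) - integral\<^sup>L \<mu> f\<bar> > \<epsilon>} \<subseteq> A n)"
      by (intro exI[of _ "\<lambda>n. {\<omega> \<in> space M. \<epsilon> \<le> \<bar>S n \<omega> / real (n - k n) - integral\<^sup>L \<mu> f\<bar>}"])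
         (auto simp: S_def intro!: always_eventually)
  qed
  have 3: "tendsto_0_in_prob M (\<lambda>n \<omega>. Z n \<omega> / real n - S n \<omega> / real (n - k n))"
  proof (rule tendsto_0_in_prob_mono)
    have "(\<lambda>n. real (k n) / real n) \<longlonglongrightarrow> 0" by (rule smalloD_tendsto[OF k(2)])
    from tendsto_mult_left[OF this, of "2 * B"] have "(\<lambda>n. 2 * B * (real (k n) / real n)) \<longlonglongrightarrow> 0" by simp
    thus "tendsto_0_in_prob M (\<lambda>n \<omega>. 2 * B * (real (k n) / real n))" by (rule tendsto_0_in_prob_const)
    have "\<forall>\<^sub>F n in sequentially. n - k n > 0"
      by (rule eventually_compose_filterlim[OF eventually_gt_at_top lim])
    thus "\<forall>\<^sub>F n in sequentially. \<forall>\<omega>\<in>space M. \<bar>Z n \<omega> / real n - S n \<omega> / real (n - k n)\<bar>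
        \<le> \<bar>2 * B * (real (k n) / real n)\<bar>"
    proof eventually_elim
      case (elim n)
      define m where "m = real (n - k n)"
      have m: "m > 0" "real n = m + real (k n)" using elim k(1)[of n] by (auto simp: m_def of_nat_diff)
      show ?case
      proof
        fix \<omega> assume "\<omega> \<in> space M"
        define T where "T = (\<Sum>l<k n. f (\<xi> n l))"
        have Z: "Z n \<omega> = S n \<omega> + T" by (simp add: Z_def S_def T_def sum_mset_proots_pn)
        have "\<bar>S n \<omega>\<bar> \<le> (\<Sum>j<n - k n. \<bar>f (X j \<omega>)\<bar>)" unfolding S_def by (rule sum_abs)
        also have "\<dots> \<le> (\<Sum>j<n - k n. B)" by (intro sum_mono B)
        finally have S: "\<bar>S n \<omega>\<bar> \<le> B * m" by (simp add: m_def mult_ac)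
        have "\<bar>T\<bar> \<le> (\<Sum>l<k n. \<bar>f (\<xi> n l)\<bar>)" unfolding T_def by (rule sum_abs)
        also have "\<dots> \<le> (\<Sum>l<k n. B)" by (intro sum_mono B)
        finally have T: "\<bar>T\<bar> \<le> B * real (k n)" by (simp add: mult_ac)
        have "Z n \<omega> / real n - S n \<omega> / m = T / real n - (S n \<omega> / m) * (real (k n) / real n)"
        proof -
          have "real n > 0" using m by simp
          hence "m / real n = 1 - real (k n) / real n" using m(2) by (simp add: field_simps)
          moreover have "S n \<omega> / real n = (S n \<omega> / m) * (m / real n)" using m(1) by simp
          ultimately show ?thesis unfolding Z add_divide_distrib by (simp add: right_diff_distrib)
        qed
        also have "\<bar>\<dots>\<bar> \<le> \<bar>T / real n\<bar> + \<bar>S n \<omega> / m\<bar> * (real (k n) / real n)"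
          by (rule order_trans[OF abs_triangle_ineq4]) (simp add: abs_mult)
        also have "\<dots> \<le> B * real (k n) / real n + B * (real (k n) / real n)"
        proof (intro add_mono mult_right_mono)
          show "\<bar>T / real n\<bar> \<le> B * real (k n) / real n" using T by (simp add: divide_right_mono)
          show "\<bar>S n \<omega> / m\<bar> \<le> B" using S m by (simp add: field_simps)
        qed auto
        also have "\<dots> = \<bar>2 * B * (real (k n) / real n)\<bar>" using B0 by (simp add: abs_mult)
        finally show "\<bar>Z n \<omega> / real n - S n \<omega> / real (n - k n)\<bar> \<le> \<bar>2 * B * (real (k n) / real n)\<bar>"
          by (simp only: m_def)
      qed
    qed
  qed
  from tendsto_0_in_prob_add[OF 1 tendsto_0_in_prob_add[OF 2 3]] show ?thesis by simp
qed

text \<open>Tightness of a single probability measure: the clipped functions \<open>\<phi> n\<close>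
  tend to 1 pointwise and are bounded by 1, so by dominated convergence their integrals tend to
  1.\<close>

lemma continuous_cutoff_exists:
  fixes \<mu> :: "complex measure"
  assumes "prob_space \<mu>" and sets: "sets \<mu> = sets borel" and "\<epsilon> > 0"
  obtains \<phi> :: "complex \<Rightarrow> real" and \<rho> where "continuous_on UNIV \<phi>" "\<And>z. cmod z > \<rho> \<Longrightarrow> \<phi> z = 0"
    "\<And>z. 0 \<le> \<phi> z" "\<And>z. \<phi> z \<le> 1" "1 - integral\<^sup>L \<mu> \<phi> < \<epsilon>"
proof -
  interpret prob_space \<mu> by fact
  define \<phi> where "\<phi> = (\<lambda>n::nat. \<lambda>z. max 0 (min 1 (real n + 1 - cmod z)))"
  have cont: "continuous_on UNIV (\<phi> n)" for n unfolding \<phi>_def by (intro continuous_intros)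
  have [measurable]: "\<phi> n \<in> borel_measurable \<mu>" for n
    using borel_measurable_continuous_onI[OF cont[of n]] sets by (simp cong: measurable_cong_sets)
  have "(\<lambda>n. integral\<^sup>L \<mu> (\<phi> n)) \<longlonglongrightarrow> (\<integral>z. 1 \<partial>\<mu>)"
  proof (rule integral_dominated_convergence[where w = "\<lambda>_. 1"])
    show "AE z in \<mu>. (\<lambda>n. \<phi> n z) \<longlonglongrightarrow> 1"
    proof (rule AE_I2)
      fix z
      have "\<forall>\<^sub>F n in sequentially. cmod z \<le> real n"
        using filterlim_real_sequentially by (simp add: filterlim_at_top)
      hence "\<forall>\<^sub>F n in sequentially. \<phi> n z = 1" by eventually_elim (auto simp: \<phi>_def)
      thus "(\<lambda>n. \<phi> n z) \<longlonglongrightarrow> 1" by (rule tendsto_eventually)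
    qed
    show "AE z in \<mu>. norm (\<phi> n z) \<le> 1" for n by (auto simp: \<phi>_def)
  qed auto
  hence "(\<lambda>n. integral\<^sup>L \<mu> (\<phi> n)) \<longlonglongrightarrow> 1" by (simp add: prob_space)
  hence "\<forall>\<^sub>F n in sequentially. integral\<^sup>L \<mu> (\<phi> n) > 1 - \<epsilon>"
    using \<open>\<epsilon> > 0\<close> by (intro order_tendstoD(1)) auto
  then obtain n where "integral\<^sup>L \<mu> (\<phi> n) > 1 - \<epsilon>" by (auto simp: eventually_sequentially)
  thus ?thesis
    by (intro that[of "\<phi> n" "real n + 1"] cont) (auto simp: \<phi>_def)
qed


text \<open>For every probability measure, replacing f by g = f \<phi> costs at most B times the
  mass that the cutoff \<phi> misses. For \<mu> this is small by the choice of \<phi>; for the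
  critical measure the integral of \<phi> is close to that under \<mu>, because \<phi> is itself a
  compactly supported test function. Thus no mass escapes to infinity.\<close>

lemma (in prob_space) crit_integral_in_prob_nondegenerate:
  fixes X :: "nat \<Rightarrow> 'a \<Rightarrow> complex" and f :: "complex \<Rightarrow> real"
  assumes indep: "indep_vars (\<lambda>_. borel) X UNIV"
    and distr: "\<And>j. distr M borel (X j) = \<mu>" and \<mu>: "prob_space \<mu>" "sets \<mu> = sets borel"
    and nondeg: "\<And>u. \<not> (AE x in \<mu>. x = u)"
    and k: "\<And>n. k n \<le> n" "(\<lambda>n. real (k n)) \<in> o(\<lambda>n. real n)"
    and f: "continuous_on UNIV f" and B: "\<And>z. \<bar>f z\<bar> \<le> B"
  shows "tendsto_0_in_prob M (\<lambda>n \<omega>. crit_integral (pn k \<xi> (\<lambda>j. X j \<omega>) n) f - integral\<^sup>L \<mu> f)"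
  unfolding tendsto_0_in_prob_def
proof (intro allI impI)
  fix \<epsilon> \<delta> :: real assume \<epsilon>: "\<epsilon> > 0" and \<delta>: "\<delta> > 0"
  interpret \<mu>: prob_space \<mu> by fact
  have B0: "B \<ge> 0" using order_trans[OF abs_ge_zero B] .
  \<comment> \<open>The missed mass is paid for twice, once for \<mu> and once for the critical
    measure, so each payment may be \<epsilon> / 4; \<open>B + 1\<close> covers B = 0.\<close>
  obtain \<phi> :: "complex \<Rightarrow> real" and \<rho> where \<phi>: "continuous_on UNIV \<phi>" "\<And>z. cmod z > \<rho> \<Longrightarrow> \<phi> z = 0"
    "\<And>z. 0 \<le> \<phi> z" "\<And>z. \<phi> z \<le> 1" and tail: "1 - integral\<^sup>L \<mu> \<phi> < \<epsilon> / (4 * (B + 1))"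
    using continuous_cutoff_exists[OF \<mu>, of "\<epsilon> / (4 * (B + 1))"] \<epsilon> B0 by auto
  have B_tail: "2 * (B * (1 - integral\<^sup>L \<mu> \<phi>)) \<le> \<epsilon> / 2"
  proof -
    have "B * (1 - integral\<^sup>L \<mu> \<phi>) \<le> B * (\<epsilon> / (4 * (B + 1)))" using tail B0 by (intro mult_left_mono) auto
    also have "\<dots> \<le> \<epsilon> / 4" using B0 \<epsilon> by (simp add: field_simps)
    finally show ?thesis by simp
  qed
  define g where "g = (\<lambda>z. f z * \<phi> z)"
  have meas: "h \<in> borel_measurable \<mu>" if "continuous_on UNIV h" for h :: "complex \<Rightarrow> real"
    using borel_measurable_continuous_onI[OF that] \<mu>(2) by (simp cong: measurable_cong_sets)
  have cont_g: "continuous_on UNIV g" unfolding g_def by (intro continuous_intros f \<phi>)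
  have g_le: "\<bar>g z\<bar> \<le> B" for z
    using mult_mono[OF B[of z] \<phi>(4)[of z]] B0 \<phi>(3)[of z] by (simp add: g_def abs_mult)
  have f_g: "\<bar>f z - g z\<bar> \<le> B * (1 - \<phi> z)" for z
  proof -
    have "\<bar>f z - g z\<bar> = \<bar>f z\<bar> * (1 - \<phi> z)"
      using \<phi>(4)[of z] by (simp add: g_def abs_mult flip: right_diff_distrib[of "f z" 1, simplified])
    thus ?thesis using B \<phi>(4)[of z] by (simp add: mult_right_mono)
  qed
  define D1 where "D1 = (\<lambda>n \<omega>. crit_integral (pn k \<xi> (\<lambda>j. X j \<omega>) n) g - integral\<^sup>L \<mu> g)"
  define D2 where "D2 = (\<lambda>n \<omega>. crit_integral (pn k \<xi> (\<lambda>j. X j \<omega>) n) \<phi> - integral\<^sup>L \<mu> \<phi>)"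
  have D1: "tendsto_0_in_prob M D1" unfolding D1_def
    by (rule crit_integral_compact_support_in_prob[OF indep distr nondeg k cont_g _ g_le, of \<rho>])
       (simp add: g_def \<phi>(2))
  have D2: "tendsto_0_in_prob M D2" unfolding D2_def
    by (rule crit_integral_compact_support_in_prob[OF indep distr nondeg k \<phi>(1,2), where B = 1])
       (use \<phi>(3,4) in auto)
  have "tendsto_0_in_prob M (\<lambda>n \<omega>. \<bar>D1 n \<omega>\<bar>)" "tendsto_0_in_prob M (\<lambda>n \<omega>. \<bar>D2 n \<omega>\<bar>)"
    by (rule tendsto_0_in_prob_mono[OF D1], simp, rule tendsto_0_in_prob_mono[OF D2], simp)
  hence "tendsto_0_in_prob M (\<lambda>n \<omega>. \<bar>D1 n \<omega>\<bar> + B * \<bar>D2 n \<omega>\<bar>)"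
    using B0 by (intro tendsto_0_in_prob_add tendsto_0_in_prob_cmult)
  moreover have "\<epsilon> / 2 > 0" using \<epsilon> by simp
  ultimately have "\<forall>\<^sub>F n in sequentially. \<exists>A\<in>sets M.
      {\<omega> \<in> space M. \<bar>\<bar>D1 n \<omega>\<bar> + B * \<bar>D2 n \<omega>\<bar>\<bar> > \<epsilon> / 2} \<subseteq> A \<and> measure M A < \<delta>"
    using \<delta> unfolding tendsto_0_in_prob_def by blast
  thus "\<forall>\<^sub>F n in sequentially. \<exists>A\<in>sets M.
      {\<omega> \<in> space M. \<bar>crit_integral (pn k \<xi> (\<lambda>j. X j \<omega>) n) f - integral\<^sup>L \<mu> f\<bar> > \<epsilon>} \<subseteq> A \<and> measure M A < \<delta>"
    using eventually_ge_at_top[of 2]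
  proof eventually_elim
    case (elim n)
    have "\<bar>crit_integral (pn k \<xi> x n) f - integral\<^sup>L \<mu> f\<bar>
      \<le> \<bar>crit_integral (pn k \<xi> x n) g - integral\<^sup>L \<mu> g\<bar>
        + B * \<bar>crit_integral (pn k \<xi> x n) \<phi> - integral\<^sup>L \<mu> \<phi>\<bar> + \<epsilon> / 2" for x
    proof -
      define Y where "Y = proots (pderiv (pn k \<xi> x n))"
      have crit: "crit_integral (pn k \<xi> x n) h = (\<Sum>y\<in>#Y. h y) / (real n - 1)" for h
        using crit_integral_eq_sum_mset[of "pn k \<xi> x n" h] k elim by (simp add: degree_pn Y_def)
      have size: "real (size Y) = real n - 1"
        using k elim by (simp add: Y_def size_proots_complex degree_pderiv degree_pn of_nat_diff)
      have sum_diff: "\<bar>(\<Sum>y\<in>#W. f y) - (\<Sum>y\<in>#W. g y)\<bar> \<le> B * (real (size W) - (\<Sum>y\<in>#W. \<phi> y))" for W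
      proof (induction W)
        case (add w W)
        thus ?case using f_g[of w] by (simp add: algebra_simps abs_le_iff)
      qed auto
      \<comment> \<open>For n = 1 the critical integral is 0 by division by zero; n >= 2 makes the
        critical measure a probability measure.\<close>
      have n: "real n - 1 > 0" using elim by simp
      have "\<bar>crit_integral (pn k \<xi> x n) f - crit_integral (pn k \<xi> x n) g\<bar>
          = \<bar>(\<Sum>y\<in>#Y. f y) - (\<Sum>y\<in>#Y. g y)\<bar> / (real n - 1)"
        using n by (simp add: crit abs_divide flip: diff_divide_distrib)
      also have "\<dots> \<le> (B * (real n - 1 - (\<Sum>y\<in>#Y. \<phi> y))) / (real n - 1)"
        using sum_diff[of Y] n by (intro divide_right_mono) (auto simp: size)
      also have "\<dots> = B * (1 - crit_integral (pn k \<xi> x n) \<phi>)"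
        using n by (simp add: crit field_simps)
      also have "\<dots> = B * (1 - integral\<^sup>L \<mu> \<phi>) - B * (crit_integral (pn k \<xi> x n) \<phi> - integral\<^sup>L \<mu> \<phi>)"
        by (simp add: algebra_simps)
      also have "\<dots> \<le> B * (1 - integral\<^sup>L \<mu> \<phi>) + B * \<bar>crit_integral (pn k \<xi> x n) \<phi> - integral\<^sup>L \<mu> \<phi>\<bar>"
        using mult_left_mono[OF abs_ge_minus_self[of "crit_integral (pn k \<xi> x n) \<phi> - integral\<^sup>L \<mu> \<phi>"] B0]
        unfolding mult_minus_right by linarith
      finally have 1: "\<bar>crit_integral (pn k \<xi> x n) f - crit_integral (pn k \<xi> x n) g\<bar>
        \<le> B * (1 - integral\<^sup>L \<mu> \<phi>) + B * \<bar>crit_integral (pn k \<xi> x n) \<phi> - integral\<^sup>L \<mu> \<phi>\<bar>" .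
      have "integrable \<mu> h" if "continuous_on UNIV h" "\<And>z. \<bar>h z\<bar> \<le> b" for h :: "complex \<Rightarrow> real" and b
        by (rule \<mu>.integrable_const_bound[of _ b]) (use that meas in auto)
      note int = this[OF f B] this[OF cont_g g_le] this[OF \<phi>(1), of 1]
      have "\<bar>integral\<^sup>L \<mu> f - integral\<^sup>L \<mu> g\<bar> = \<bar>\<integral>z. f z - g z \<partial>\<mu>\<bar>" using int by simp
      also have "\<dots> \<le> (\<integral>z. \<bar>f z - g z\<bar> \<partial>\<mu>)" by (rule integral_abs_bound)
      also have "\<dots> \<le> (\<integral>z. B * (1 - \<phi> z) \<partial>\<mu>)"
        by (rule integral_mono) (use int \<phi>(3,4) f_g in auto)
      also have "\<dots> = B * (1 - integral\<^sup>L \<mu> \<phi>)" using int(3) \<phi>(3,4) by (simp add: \<mu>.prob_space)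
      finally have 2: "\<bar>integral\<^sup>L \<mu> f - integral\<^sup>L \<mu> g\<bar> \<le> B * (1 - integral\<^sup>L \<mu> \<phi>)" .
      show ?thesis using 1 2 B_tail by linarith
    qed
    hence "\<bar>crit_integral (pn k \<xi> (\<lambda>j. X j \<omega>) n) f - integral\<^sup>L \<mu> f\<bar> \<le> \<bar>D1 n \<omega>\<bar> + B * \<bar>D2 n \<omega>\<bar> + \<epsilon> / 2" for \<omega>
      by (simp add: D1_def D2_def)
    hence "{\<omega> \<in> space M. \<bar>crit_integral (pn k \<xi> (\<lambda>j. X j \<omega>) n) f - integral\<^sup>L \<mu> f\<bar> > \<epsilon>}
        \<subseteq> {\<omega> \<in> space M. \<bar>\<bar>D1 n \<omega>\<bar> + B * \<bar>D2 n \<omega>\<bar>\<bar> > \<epsilon> / 2}"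
      by (smt (verit, best) Collect_mono_iff field_sum_of_halves)
    thus ?case using elim(1) by (meson subset_trans)
  qed
qed

section \<open>Point masses\<close>

text \<open>The point a is a root of order at least n - k_n (more if some \<xi> equals a), hence a
  zero of p' of order at least n - k_n - 1. Of the n - 1 critical points this leaves k_n, collected
  in \<open>W\<close>, each changing the sum by at most 2 B.\<close>

lemma crit_integral_point_mass_le:
  fixes f :: "complex \<Rightarrow> real"
  assumes B: "\<And>z. \<bar>f z\<bar> \<le> B" and n: "n \<ge> 2" "k n < n" and x: "\<And>j. x j = a"
  shows "\<bar>crit_integral (pn k \<xi> x n) f - f a\<bar> \<le> 2 * B * (real (k n) / (real n - 1))"
proof -
  define p where "p = pn k \<xi> x n"
  have p: "lead_coeff p = 1" "degree p = n" "p \<noteq> 0"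
    using n lead_coeff_pn[of k \<xi> x n] by (auto simp: p_def degree_pn)
  have p': "pderiv p \<noteq> 0" using p n by (intro pderiv_neq_0) auto
  have "(\<Sum>j<m. {#a#}) = replicate_mset m a" for m by (induction m) auto
  hence ord: "order a p \<ge> n - k n"
    using p(3) unfolding p_def by (simp flip: count_proots add: proots_pn x)
  hence "poly p a = 0" using n p(3) by (simp add: order_root)
  from order_pderiv[OF p(3) this] have "order a (pderiv p) \<ge> n - k n - 1" using ord by simp
  hence "replicate_mset (n - k n - 1) a \<subseteq># proots (pderiv p)"
    unfolding count_le_replicate_mset_subset_eq[symmetric] using p' by simp
  then obtain W where W: "proots (pderiv p) = replicate_mset (n - k n - 1) a + W"
    by (metis subset_mset.add_diff_inverse)
  have "size (proots (pderiv p)) = n - 1" using p by (simp add: size_proots_complex degree_pderiv)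
  hence size: "size W = k n" using n by (simp add: W)
  have "(\<Sum>y\<in>#proots (pderiv p). f y) - (real n - 1) * f a = (\<Sum>y\<in>#W. f y - f a)"
  proof -
    have "(\<Sum>y\<in>#W. f y - f a) = (\<Sum>y\<in>#W. f y) - real (size W) * f a"
      by (induction W) (auto simp: algebra_simps)
    moreover have "(\<Sum>y\<in>#replicate_mset m a. f y) = real m * f a" for m by simp
    ultimately show ?thesis using n by (simp add: W size of_nat_diff algebra_simps)
  qed
  moreover have "\<bar>\<Sum>y\<in>#W. f y - f a\<bar> \<le> 2 * B * real (size W)"
  proof (rule abs_sum_mset_le)
    show "\<bar>f y - f a\<bar> \<le> 2 * B" for y using B[of y] B[of a] by linarith
  qed
  ultimately have le: "\<bar>(\<Sum>y\<in>#proots (pderiv p). f y) - (real n - 1) * f a\<bar> \<le> 2 * B * real (k n)"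
    by (simp add: size)
  have n1: "real n - 1 > 0" using n by simp
  have "crit_integral p f - f a = ((\<Sum>y\<in>#proots (pderiv p). f y) - (real n - 1) * f a) / (real n - 1)"
    using crit_integral_eq_sum_mset[of p f] p n n1 by (simp add: field_simps)
  hence "\<bar>crit_integral p f - f a\<bar> = \<bar>(\<Sum>y\<in>#proots (pderiv p). f y) - (real n - 1) * f a\<bar> / (real n - 1)"
    using n1 by (simp add: abs_divide)
  also have "\<dots> \<le> 2 * B * real (k n) / (real n - 1)" using le n1 by (intro divide_right_mono) auto
  finally show ?thesis by (simp add: p_def)
qed

text \<open>One null event serves all n: off it every X_j equals the atom a, and the deterministic
  bound applies, with k_n / (n - 1) tending to 0.\<close>

lemma (in prob_space) crit_integral_in_prob_degenerate:
  fixes X :: "nat \<Rightarrow> 'a \<Rightarrow> complex" and f :: "complex \<Rightarrow> real"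
  assumes X [measurable]: "\<And>j. X j \<in> borel_measurable M"
    and distr: "\<And>j. distr M borel (X j) = \<mu>" and \<mu>: "prob_space \<mu>" "sets \<mu> = sets borel"
    and deg: "AE x in \<mu>. x = a"
    and k: "\<And>n. k n \<le> n" "(\<lambda>n. real (k n)) \<in> o(\<lambda>n. real n)"
    and f: "continuous_on UNIV f" and B: "\<And>z. \<bar>f z\<bar> \<le> B"
  shows "tendsto_0_in_prob M (\<lambda>n \<omega>. crit_integral (pn k \<xi> (\<lambda>j. X j \<omega>) n) f - integral\<^sup>L \<mu> f)"
proof (rule tendsto_0_in_probI)
  fix \<epsilon> :: real assume \<epsilon>: "\<epsilon> > 0"
  interpret \<mu>: prob_space \<mu> by fact
  have "f \<in> borel_measurable \<mu>"
    using borel_measurable_continuous_onI[OF f] \<mu>(2) by (simp cong: measurable_cong_sets)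
  hence "integral\<^sup>L \<mu> f = (\<integral>x. f a \<partial>\<mu>)"
    using deg by (intro integral_cong_AE) auto
  hence fa: "integral\<^sup>L \<mu> f = f a" by (simp add: \<mu>.prob_space)
  define A where "A = {\<omega> \<in> space M. \<exists>j. X j \<omega> \<noteq> a}"
  have [measurable]: "A \<in> events" unfolding A_def by measurable
  have "AE \<omega> in M. X j \<omega> = a" for j
    using deg unfolding distr[of j, symmetric] by (subst (asm) AE_distr_iff) auto
  hence "AE \<omega> in M. \<forall>j. X j \<omega> = a" by (simp add: AE_all_countable)
  hence "AE \<omega> in M. \<omega> \<notin> A" by eventually_elim (auto simp: A_def)
  hence A0: "prob A = 0" by (simp add: AE_iff_null_sets measure_eq_0_null_sets)
  have "(\<lambda>n. real (k n) / real n) \<longlonglongrightarrow> 0" by (rule smalloD_tendsto[OF k(2)])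
  moreover have "(\<lambda>n. real n / (real n - 1)) \<longlonglongrightarrow> 1" by real_asymp
  ultimately have "(\<lambda>n. 2 * B * ((real (k n) / real n) * (real n / (real n - 1)))) \<longlonglongrightarrow> 2 * B * (0 * 1)"
    by (intro tendsto_intros)
  hence "\<forall>\<^sub>F n in sequentially. 2 * B * ((real (k n) / real n) * (real n / (real n - 1))) < \<epsilon>"
    using \<epsilon> by (intro order_tendstoD(2)) auto
  moreover have "\<forall>\<^sub>F n in sequentially. n - k n > 0"
    by (rule eventually_compose_filterlim[OF eventually_gt_at_top smallo_diff_at_top[OF k(2)]])
  ultimately have "\<forall>\<^sub>F n in sequentially.
      {\<omega> \<in> space M. \<bar>crit_integral (pn k \<xi> (\<lambda>j. X j \<omega>) n) f - integral\<^sup>L \<mu> f\<bar> > \<epsilon>} \<subseteq> A"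
    using eventually_ge_at_top[of 2]
  proof eventually_elim
    case (elim n)
    show ?case
    proof (rule subsetI, rule ccontr)
      fix \<omega> assume *: "\<omega> \<in> {\<omega> \<in> space M. \<bar>crit_integral (pn k \<xi> (\<lambda>j. X j \<omega>) n) f - integral\<^sup>L \<mu> f\<bar> > \<epsilon>}" "\<omega> \<notin> A"
      hence "X j \<omega> = a" for j by (auto simp: A_def)
      hence "\<bar>crit_integral (pn k \<xi> (\<lambda>j. X j \<omega>) n) f - f a\<bar> \<le> 2 * B * (real (k n) / (real n - 1))"
        using elim by (intro crit_integral_point_mass_le B) auto
      also have "\<dots> < \<epsilon>" using elim by simp
      finally show False using * by (simp add: fa)
    qed
  qed
  thus "\<exists>A. (\<forall>n. A n \<in> events) \<and> (\<lambda>n. prob (A n)) \<longlonglongrightarrow> 0 \<and>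
      (\<forall>\<^sub>F n in sequentially. {\<omega> \<in> space M.
         \<bar>crit_integral (pn k \<xi> (\<lambda>j. X j \<omega>) n) f - integral\<^sup>L \<mu> f\<bar> > \<epsilon>} \<subseteq> A n)"
    by (intro exI[of _ "\<lambda>_. A"]) (auto simp: A0)
qed

text \<open>The conclusion says that the outer measure of the deviation set tends to 0; whenever
  that set is an event, monotonicity turns this into the usual statement on its probability. The
  case split is on whether \<mu> is a point mass, since the anti-concentration argument requires a
  nondegenerate law.\<close>

theorem mainTheorem1:
  fixes M :: "'a measure" and \<mu> :: "complex measure"
    and X :: "nat \<Rightarrow> 'a \<Rightarrow> complex"
    and k :: "nat \<Rightarrow> nat" and \<xi> :: "nat \<Rightarrow> nat \<Rightarrow> complex"
    and f :: "complex \<Rightarrow> real" and \<epsilon> :: real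
  assumes "prob_space M"
    and "prob_space \<mu>" and "sets \<mu> = sets borel"
    and "\<And>j. X j \<in> borel_measurable M"
    and "\<And>j. distr M borel (X j) = \<mu>"
    and "prob_space.indep_vars M (\<lambda>_. borel) X UNIV"
    and "\<And>n. k n \<le> n"
    and "(\<lambda>n. real (k n)) \<in> o(\<lambda>n. real n)"
    and "continuous_on UNIV f" and "bounded (range f)"
    and "\<epsilon> > 0"
  shows "\<forall>\<delta>>0. \<forall>\<^sub>F n in sequentially. \<exists>A\<in>sets M.
           {\<omega> \<in> space M. \<bar>crit_integral (pn k \<xi> (\<lambda>j. X j \<omega>) n) f - integral\<^sup>L \<mu> f\<bar> > \<epsilon>} \<subseteq> A
           \<and> measure M A < \<delta>"
proof -
  interpret prob_space M by fact
  obtain B where B: "\<And>z. \<bar>f z\<bar> \<le> B"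
    using assms(10) unfolding bounded_iff by (metis rangeI real_norm_def)
  have "tendsto_0_in_prob M (\<lambda>n \<omega>. crit_integral (pn k \<xi> (\<lambda>j. X j \<omega>) n) f - integral\<^sup>L \<mu> f)"
  proof (cases "\<exists>a. AE x in \<mu>. x = a")
    case True
    then obtain a where "AE x in \<mu>. x = a" by blast
    thus ?thesis
      using assms(2-5,7-9) B by (intro crit_integral_in_prob_degenerate) auto
  next
    case False
    thus ?thesis
      using assms(2,3,5-9) B by (intro crit_integral_in_prob_nondegenerate) auto
  qed
  thus ?thesis using assms(11) unfolding tendsto_0_in_prob_def by blast
qed

end
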